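(* Let $N\ge2$ and let $m\ge1$ be an integer. Let $\lambda=m\lambda_1$ be a multiple of the first fundamental weight of $A_{N-1}$, let $\mu=a_1\lambda_1+\dots+a_{N-1}\lambda_{N-1}$ be any dominant integral weight, and let $[\lambda],[\mu]$ be the corresponding $S_\infty$-orbits in $\bar G_N$. Then for every dominant integral weight $\nu$, $$c_{(\mu),(\lambda)}^{(\nu)}=M_{[\mu],[\lambda]}^{[\nu]}.$$
   Context: Weights: $\lambda_1,\dots,\lambda_{N-1}$ are the fundamental weights of $sl_N$; dominant integral weights are $P^+=\{\sum_{j=1}^{N-1}a_j\lambda_j : a_j\in\mathbb{Z}_{\ge0}\}$. To $\lambda=\sum a_j\lambda_j\in P^+$ associate the partition $(\lambda)=(\sum_{j\ge1}a_j,\sum_{j\ge2}a_j,\dots,a_{N-1})$. Orbits: $\bar G_N=\bigoplus_{i=1}^\infty\mathbb{Z}_N$ is the group of finitely supported sequences in $\mathbb{Z}_N=\mathbb{Z}/N\mathbb{Z}$; $S_\infty$, the group of permutations of $\{1,2,\dots\}$ fixing all but finitely many numbers, acts on it by permuting coordinates. The weight $\sum a_j\lambda_j\in P^+$ corresponds bijectively to the $S_\infty$-orbit $[((N-1)^{a_{N-1}},\dots,1^{a_1},0,0,\dots)]$ (exponents denote repetitions). For $S_\infty$-orbits $[a],[b],[c]$, $T([a],[b],[c])=\{(x,y,z)\in[a]\times[b]\times[c] : x+y=z\}$ with diagonal $S_\infty$-action, and $M_{[a],[b]}^{[c]}$ is the number of $S_\infty$-orbits of $T([a],[b],[c])$.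 Coefficients: Let $\Lambda_N=\mathbb{Q}[x_1,\dots,x_N]^{S_N}$ with Schur polynomials $S_{(\mu)}=\det(h_{\mu_i-i+j})_{i,j=1}^N$ for partitions of length at most $N$ ($h_m$ complete homogeneous, $h_0=1$, $h_m=0$ for $m<0$). The classes of $S_{(\lambda)}$, $\lambda\in P^+$, form a basis of $\Lambda_N/\langle S_{(1^N)}-1\rangle$, and $c_{(\mu),(\lambda)}^{(\nu)}$ are defined by $S_{(\mu)}S_{(\lambda)}=\sum_{\nu\in P^+}c_{(\mu),(\lambda)}^{(\nu)}S_{(\nu)}$ in $\Lambda_N/\langle S_{(1^N)}-1\rangle$; equivalently $c_{(\mu),(\lambda)}^{(\nu)}$ is the multiplicity of the irreducible $sl_N$-module $V^\nu$ in $V^\mu\otimes V^\lambda$. *)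

theory Defs
  imports
    "HOL-Library.Poly_Mapping"
    "HOL-Combinatorics.Permutations"
    "HOL-Algebra.QuotRing"
    "HOL-Algebra.Group_Action"
    "HOL-Algebra.Product_Groups"
    "Jordan_Normal_Form.Determinant"
begin

section \<open>Dominant integral weights of type \<open>A\<close>\<close>

text \<open>
  A weight is given by its coordinates in the basis of fundamental weights: \<open>lookup a j\<close> is the
  coefficient of \<open>\<lambda>\<^sub>j\<close>, so that \<open>Poly_Mapping.single j m\<close> is \<open>m \<lambda>\<^sub>j\<close>. Since these coordinates
  are unique and vanish outside \<open>{1..N-1}\<close>, different elements of \<open>dominant_weights N\<close> are
  different weights.
\<close>

type_synonym weight = "nat \<Rightarrow>\<^sub>0 nat"

definition dominant_weights :: "nat \<Rightarrow> weight set" where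
  "dominant_weights N = {a. Poly_Mapping.keys a \<subseteq> {1..N - 1}}"

definition weight_partition :: "nat \<Rightarrow> weight \<Rightarrow> nat \<Rightarrow> nat" where
  "weight_partition N a i = (\<Sum>j = i..N - 1. Poly_Mapping.lookup a j)"

section \<open>Symmetric polynomials\<close>

text \<open>
  Polynomials over the rationals: an exponent vector \<open>\<alpha> :: nat \<Rightarrow>\<^sub>0 nat\<close> stands for the monomial
  \<open>\<Prod>i. x\<^sub>i ^ lookup \<alpha> i\<close>, and multiplication is the convolution product of
  \<^theory>\<open>HOL-Library.Poly_Mapping\<close>.
\<close>

type_synonym rat_poly = "(nat \<Rightarrow>\<^sub>0 nat) \<Rightarrow>\<^sub>0 rat"

definition const_poly :: "rat \<Rightarrow> rat_poly" where
  "const_poly q = Poly_Mapping.single 0 q"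

text \<open>
  For a permutation \<open>p\<close>, this is the polynomial obtained by substituting \<open>x\<^bsub>p i\<^esub>\<close> for \<open>x\<^sub>i\<close>:
  its coefficient at \<open>\<beta>\<close> is the coefficient of \<open>f\<close> at the exponent vector \<open>i \<mapsto> \<beta> (p i)\<close>.
\<close>

definition permute_vars :: "(nat \<Rightarrow> nat) \<Rightarrow> rat_poly \<Rightarrow> rat_poly" where
  "permute_vars p f = Poly_Mapping.map_key (Poly_Mapping.map_key p) f"

definition sym_polys :: "nat \<Rightarrow> rat_poly set" where
  "sym_polys N = {f. (\<forall>\<alpha> \<in> Poly_Mapping.keys f. Poly_Mapping.keys \<alpha> \<subseteq> {1..N}) \<and>
                     (\<forall>p. p permutes {1..N} \<longrightarrow> permute_vars p f = f)}"

definition sym_ring :: "nat \<Rightarrow> rat_poly ring" where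
  "sym_ring N = \<lparr>carrier = sym_polys N, monoid.mult = (*), one = 1, zero = 0, add = (+)\<rparr>"

definition complete_sym :: "nat \<Rightarrow> int \<Rightarrow> rat_poly" where
  "complete_sym N m =
     (\<Sum>\<alpha> \<in> {\<alpha>. Poly_Mapping.keys \<alpha> \<subseteq> {1..N} \<and> int (\<Sum>i = 1..N. Poly_Mapping.lookup \<alpha> i) = m}.
        Poly_Mapping.single \<alpha> 1)"

text \<open>
  A partition of length at most \<open>N\<close> is given by its parts \<open>\<mu> 1, \<dots>, \<mu> N\<close>; rows and columns of
  matrices are counted from \<open>0\<close>, which does not affect the difference \<open>j - i\<close>.
\<close>

definition schur :: "nat \<Rightarrow> (nat \<Rightarrow> nat) \<Rightarrow> rat_poly" where
  "schur N \<mu> = det (mat N N (\<lambda>(i, j). complete_sym N (int (\<mu> (Suc i)) - int i + int j)))"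

section \<open>The quotient ring and the coefficients\<close>

definition sl_ideal :: "nat \<Rightarrow> rat_poly set" where
  "sl_ideal N = Idl\<^bsub>sym_ring N\<^esub> {schur N (\<lambda>_. 1) - 1}"

definition sl_ring :: "nat \<Rightarrow> rat_poly set ring" where
  "sl_ring N = sym_ring N Quot sl_ideal N"

definition poly_class :: "nat \<Rightarrow> rat_poly \<Rightarrow> rat_poly set" where
  "poly_class N f = sl_ideal N +>\<^bsub>sym_ring N\<^esub> f"

definition schur_class :: "nat \<Rightarrow> weight \<Rightarrow> rat_poly set" where
  "schur_class N a = poly_class N (schur N (weight_partition N a))"

definition schur_expansion :: "nat \<Rightarrow> weight \<Rightarrow> weight \<Rightarrow> (weight \<Rightarrow>\<^sub>0 rat) \<Rightarrow> bool" where
  "schur_expansion N \<mu> lam c \<longleftrightarrow>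
     Poly_Mapping.keys c \<subseteq> dominant_weights N \<and>
     schur_class N \<mu> \<otimes>\<^bsub>sl_ring N\<^esub> schur_class N lam =
       (\<Oplus>\<^bsub>sl_ring N\<^esub> \<nu> \<in> Poly_Mapping.keys c.
          poly_class N (const_poly (Poly_Mapping.lookup c \<nu>)) \<otimes>\<^bsub>sl_ring N\<^esub> schur_class N \<nu>)"

text \<open>
  The expansion \<open>c\<close> exists and is unique because the classes of the \<open>S\<^bsub>(\<nu>)\<^esub>\<close>, \<open>\<nu>\<close> dominant, form a
  basis of the quotient ring over the rationals.
\<close>

definition lr_coeff :: "nat \<Rightarrow> weight \<Rightarrow> weight \<Rightarrow> weight \<Rightarrow> rat" where
  "lr_coeff N \<mu> lam \<nu> = Poly_Mapping.lookup (THE c. schur_expansion N \<mu> lam c) \<nu>"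

section \<open>Orbits of finitely supported sequences\<close>

text \<open>
  The coordinates of a sequence are indexed by \<open>0, 1, 2, \<dots>\<close>, and \<open>\<int>\<^sub>N\<close> is represented by
  \<open>{0..<N}\<close> with addition modulo \<open>N\<close>.
\<close>

definition seq_group :: "nat \<Rightarrow> (nat \<Rightarrow> int) monoid" where
  "seq_group N = sum_group UNIV (\<lambda>_. integer_mod_group N)"

text \<open>
  \<open>permutation p\<close> means that \<open>p\<close> is a bijection with \<open>p i \<noteq> i\<close> for only finitely many \<open>i\<close>.
\<close>

definition S_inf :: "(nat \<Rightarrow> nat) monoid" where
  "S_inf = \<lparr>carrier = {p. permutation p}, monoid.mult = (\<circ>), one = id\<rparr>"

definition seq_act :: "(nat \<Rightarrow> nat) \<Rightarrow> (nat \<Rightarrow> int) \<Rightarrow> nat \<Rightarrow> int" where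
  "seq_act p x = x \<circ> inv_into UNIV p"

definition diag_act ::
  "(nat \<Rightarrow> nat) \<Rightarrow> (nat \<Rightarrow> int) \<times> (nat \<Rightarrow> int) \<times> (nat \<Rightarrow> int)
     \<Rightarrow> (nat \<Rightarrow> int) \<times> (nat \<Rightarrow> int) \<times> (nat \<Rightarrow> int)" where
  "diag_act p = (\<lambda>(x, y, z). (seq_act p x, seq_act p y, seq_act p z))"

definition weight_seq :: "nat \<Rightarrow> weight \<Rightarrow> nat \<Rightarrow> int" where
  "weight_seq N a i =
     (let xs = concat (map (\<lambda>j. replicate (Poly_Mapping.lookup a j) (int j)) (rev [1..<N]))
      in if i < length xs then xs ! i else 0)"

definition weight_orbit :: "nat \<Rightarrow> weight \<Rightarrow> (nat \<Rightarrow> int) set" where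
  "weight_orbit N a = orbit S_inf seq_act (weight_seq N a)"

definition sum_triples ::
  "nat \<Rightarrow> (nat \<Rightarrow> int) set \<Rightarrow> (nat \<Rightarrow> int) set \<Rightarrow> (nat \<Rightarrow> int) set
     \<Rightarrow> ((nat \<Rightarrow> int) \<times> (nat \<Rightarrow> int) \<times> (nat \<Rightarrow> int)) set" where
  "sum_triples N A B C = {(x, y, z) \<in> A \<times> B \<times> C. x \<otimes>\<^bsub>seq_group N\<^esub> y = z}"

text \<open>
  For orbits \<open>A\<close>, \<open>B\<close>, \<open>C\<close> the number of orbits counted here is finite: up to permutation, the
  supports of \<open>x\<close>, \<open>y\<close> and \<open>z\<close> lie in a fixed finite set of coordinates.
\<close>

definition orbit_number ::
  "nat \<Rightarrow> (nat \<Rightarrow> int) set \<Rightarrow> (nat \<Rightarrow> int) set \<Rightarrow> (nat \<Rightarrow> int) set \<Rightarrow> nat" where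
  "orbit_number N A B C = card (orbits S_inf (sum_triples N A B C) diag_act)"

end

theory Submission
  imports Defs "HOL-Computational_Algebra.Polynomial_FPS"
begin

text \<open>
  Since \<open>\<lambda> = m \<lambda>\<^sub>1\<close>, the Schur polynomial of \<open>\<lambda>\<close> is the complete symmetric polynomial
  \<open>h\<^sub>m\<close>, and both numbers count the same vectors. They are the \<open>\<beta> = (\<beta>\<^sub>0, \<dots>, \<beta>\<^bsub>N-1\<^esub>)\<close> of natural
  numbers with sum \<open>m\<close> such that \<open>\<beta>\<^sub>j \<le> a\<^sub>j\<close> for \<open>1 \<le> j < N\<close> and such that the weight with
  coordinates \<open>a\<^sub>j + \<beta>\<^bsub>j-1\<^esub> - \<beta>\<^sub>j\<close> is \<open>\<nu>\<close>.

  On the algebraic side this is Pieri's rule: \<open>S\<^bsub>(\<mu>)\<^esub> h\<^sub>m\<close> is the sum of the \<open>S\<^bsub>\<kappa>\<^esub>\<close> for which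
  \<open>\<kappa> / (\<mu>)\<close> is a horizontal strip of size \<open>m\<close>. If row \<open>i + 1\<close> of the strip has \<open>\<beta>\<^sub>i\<close> boxes, the strip
  condition is \<open>\<beta>\<^sub>j \<le> a\<^sub>j\<close>, and the weight of \<open>\<kappa>\<close> has the coordinates above. Rows of \<open>\<kappa>\<close> can be
  shortened to make the last one vanish, because this divides \<open>S\<^bsub>\<kappa>\<^esub>\<close> by a power of
  \<open>S\<^bsub>(1^N)\<^esub> = x\<^sub>1 \<cdots> x\<^sub>N\<close>, which becomes \<open>1\<close> in the quotient.
  The rule is proved for alternants \<open>det (x\<^sub>k ^ \<gamma>\<^sub>i)\<close> (\<open>alternant_pieri\<close>), where multiplication by \<open>h\<^sub>m\<close>
  adds all vectors of size \<open>m\<close> to the exponents and an involution cancels those that are not strips.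
  It passes to the Jacobi-Trudi determinants because such a determinant times the Vandermonde
  determinant is an alternant (\<open>alternant_eq_jacobi_trudi\<close>).

  The coefficients are determined by the expansion because the Schur polynomials of dominant
  weights are independent modulo \<open>x\<^sub>1 \<cdots> x\<^sub>N - 1\<close> (\<open>schur_independent_mod_ones\<close>): after
  multiplication with the Vandermonde determinant, no monomial of a combination of them is divisible
  by \<open>x\<^sub>1 \<cdots> x\<^sub>N\<close>, and a nonzero multiple of \<open>x\<^sub>1 \<cdots> x\<^sub>N - 1\<close> always has such a monomial.

  On the side of orbits, let \<open>\<beta>\<^sub>j\<close> be the number of positions where \<open>x\<close> is \<open>j\<close> and \<open>y\<close> is \<open>1\<close>. All other
  entries of \<open>y\<close> are \<open>0\<close>, so these numbers determine the triple \<open>(x, y, x + y)\<close> up to a permutation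
  of the positions, and adding \<open>y\<close> moves \<open>\<beta>\<^sub>j\<close> of the entries \<open>j\<close> of \<open>x\<close> to \<open>j + 1\<close>. Hence \<open>\<beta>\<^sub>j \<le> a\<^sub>j\<close>
  for \<open>j \<ge> 1\<close>, whereas \<open>\<beta>\<^sub>0\<close> is unbounded as \<open>x\<close> has infinitely many zeros, and \<open>x + y\<close> has
  \<open>a\<^sub>j + \<beta>\<^bsub>j-1\<^esub> - \<beta>\<^sub>j\<close> entries \<open>j\<close> (\<open>orbit_number_eq_card_pieri_strips\<close>).
\<close>

section \<open>Complete homogeneous symmetric polynomials\<close>

definition compositions :: "nat \<Rightarrow> nat \<Rightarrow> (nat \<Rightarrow> nat) set" where
  "compositions N m = {\<beta>. (\<forall>i\<ge>N. \<beta> i = 0) \<and> (\<Sum>i<N. \<beta> i) = m}"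

lemma compositionsD:
  assumes "\<beta> \<in> compositions N m"
  shows "N \<le> i \<Longrightarrow> \<beta> i = 0" "(\<Sum>i<N. \<beta> i) = m" "\<beta> i \<le> m"
proof -
  show 1: "N \<le> i \<Longrightarrow> \<beta> i = 0" and 2: "(\<Sum>i<N. \<beta> i) = m"
    using assms by (auto simp: compositions_def)
  show "\<beta> i \<le> m"
  proof (cases "i < N")
    case True
    then have "\<beta> i \<le> (\<Sum>i<N. \<beta> i)" by (intro member_le_sum) auto
    with 2 show ?thesis by simp
  qed (use 1 in auto)
qed

lemma finite_compositions: "finite (compositions N m)"
proof (rule finite_subset)
  show "compositions N m \<subseteq> {\<beta>. \<forall>i. (i \<in> {..<N} \<longrightarrow> \<beta> i \<in> {..m}) \<and> (i \<notin> {..<N} \<longrightarrow> \<beta> i = 0)}"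
    by (auto simp: compositionsD)
qed (intro finite_set_of_finite_funs finite_lessThan finite_atMost)

lemma compositions_0: "compositions 0 m = (if m = 0 then {\<lambda>_. 0} else {})"
  by (auto simp: compositions_def)

lemma compositions_sum_0: "compositions N 0 = {\<lambda>_. 0}"
  by (auto simp: compositions_def fun_eq_iff) (metis lessThan_iff not_le)

lemma compositions_Suc_Suc:
  "compositions (Suc N) (Suc m) =
     compositions N (Suc m) \<union> (\<lambda>\<beta>. \<beta>(N := Suc (\<beta> N))) ` compositions (Suc N) m"
proof (intro equalityI subsetI)
  fix \<beta> assume b: "\<beta> \<in> compositions (Suc N) (Suc m)"
  show "\<beta> \<in> compositions N (Suc m) \<union> (\<lambda>\<beta>. \<beta>(N := Suc (\<beta> N))) ` compositions (Suc N) m"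
  proof (cases "\<beta> N")
    case 0
    with b have "\<beta> \<in> compositions N (Suc m)"
      by (auto simp: compositions_def) (metis le_antisym not_less_eq_eq)
    then show ?thesis by blast
  next
    case (Suc c)
    have "\<beta>(N := c) \<in> compositions (Suc N) m"
      using b Suc by (auto simp: compositions_def)
    moreover have "\<beta> = (\<beta>(N := c))(N := Suc ((\<beta>(N := c)) N))"
      using Suc by auto
    ultimately show ?thesis by blast
  qed
next
  fix \<beta> assume "\<beta> \<in> compositions N (Suc m) \<union> (\<lambda>\<beta>. \<beta>(N := Suc (\<beta> N))) ` compositions (Suc N) m"
  then show "\<beta> \<in> compositions (Suc N) (Suc m)"
    by (auto simp: compositions_def)
qed

lemma compositions_permute:
  assumes p: "p permutes {..<N}" and b: "\<beta> \<in> compositions N m"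
  shows "\<beta> \<circ> p \<in> compositions N m"
proof -
  have "(\<Sum>i<N. \<beta> (p i)) = (\<Sum>i<N. \<beta> i)"
    using sum.permute[OF p, of \<beta>] by (simp add: o_def)
  moreover have "\<beta> (p i) = 0" if "i \<ge> N" for i
    using that permutes_not_in[OF p, of i] compositionsD(1)[OF b, of i] by auto
  ultimately show ?thesis
    using compositionsD(2)[OF b] by (auto simp: compositions_def)
qed

definition hsym :: "(nat \<Rightarrow> 'a::comm_ring_1) \<Rightarrow> nat \<Rightarrow> nat \<Rightarrow> 'a" where
  "hsym x N m = (\<Sum>\<beta>\<in>compositions N m. \<Prod>i<N. x i ^ \<beta> i)"

lemma hsym_0: "hsym x 0 m = (if m = 0 then 1 else 0)"
  by (simp add: hsym_def compositions_0)

lemma hsym_degree_0: "hsym x N 0 = 1"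
  by (simp add: hsym_def compositions_sum_0)

text \<open>
  The monomials without \<open>x\<^sub>N\<close> give the first summand; the others are \<open>x\<^sub>N\<close> times an arbitrary
  monomial of degree \<open>m\<close>.
\<close>

lemma hsym_Suc_Suc: "hsym x (Suc N) (Suc m) = hsym x N (Suc m) + x N * hsym x (Suc N) m"
proof -
  let ?up = "\<lambda>\<beta>::nat \<Rightarrow> nat. \<beta>(N := Suc (\<beta> N))"
  have inj: "inj_on ?up A" for A
  proof (rule inj_onI, rule ext)
    fix \<beta> \<beta>' :: "nat \<Rightarrow> nat" and i assume "?up \<beta> = ?up \<beta>'"
    then have "?up \<beta> i = ?up \<beta>' i" by simp
    then show "\<beta> i = \<beta>' i" by (simp split: if_splits)
  qed
  have disj: "compositions N (Suc m) \<inter> ?up ` compositions (Suc N) m = {}"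
    by (auto simp: compositions_def)
  have "hsym x (Suc N) (Suc m) = (\<Sum>\<beta>\<in>compositions N (Suc m). \<Prod>i<Suc N. x i ^ \<beta> i)
      + (\<Sum>\<beta>\<in>?up ` compositions (Suc N) m. \<Prod>i<Suc N. x i ^ \<beta> i)"
    unfolding hsym_def compositions_Suc_Suc
    by (intro sum.union_disjoint disj finite_compositions finite_imageI)
  also have "(\<Sum>\<beta>\<in>compositions N (Suc m). \<Prod>i<Suc N. x i ^ \<beta> i) = hsym x N (Suc m)"
    unfolding hsym_def by (intro sum.cong) (auto simp: compositionsD)
  also have "(\<Sum>\<beta>\<in>?up ` compositions (Suc N) m. \<Prod>i<Suc N. x i ^ \<beta> i)
      = (\<Sum>\<beta>\<in>compositions (Suc N) m. \<Prod>i<Suc N. x i ^ ?up \<beta> i)"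
    by (subst sum.reindex[OF inj]) simp
  also have "\<dots> = x N * hsym x (Suc N) m"
    unfolding hsym_def sum_distrib_left
    by (intro sum.cong) (auto simp: algebra_simps)
  finally show ?thesis .
qed

text \<open>
  The recurrence says that the factor \<open>1 - x\<^sub>N t\<close> removes the last variable from the generating
  function.
\<close>

lemma hsym_generating_function:
  "Abs_fps (hsym x N) * (\<Prod>i<N. 1 - fps_const (x i) * fps_X) = (1 :: 'a::comm_ring_1 fps)"
proof (induction N)
  case 0
  show ?case by (simp add: fps_eq_iff hsym_0)
next
  case (Suc N)
  have "Abs_fps (hsym x (Suc N)) * (1 - fps_const (x N) * fps_X) = Abs_fps (hsym x N)"
  proof (rule fps_ext)
    fix n
    show "fps_nth (Abs_fps (hsym x (Suc N)) * (1 - fps_const (x N) * fps_X)) n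
        = fps_nth (Abs_fps (hsym x N)) n"
      by (cases n) (simp_all add: right_diff_distrib mult.assoc[symmetric] hsym_degree_0 hsym_Suc_Suc
          mult.commute[of "x N"])
  qed
  then show ?case
    using Suc.IH by (simp add: mult.assoc[symmetric] mult.commute[of "prod _ _"])
qed

lemma geometric_fps:
  "Abs_fps (\<lambda>n. c ^ n) * (1 - fps_const c * fps_X) = (1 :: 'a::comm_ring_1 fps)"
proof (rule fps_ext)
  fix n
  show "fps_nth (Abs_fps (\<lambda>n. c ^ n) * (1 - fps_const c * fps_X)) n = fps_nth (1 :: 'a fps) n"
    by (cases n) (simp_all add: right_diff_distrib mult.assoc[symmetric] mult.commute[of c])
qed

text \<open>
  Entries of Jacobi-Trudi matrices may have a negative degree.
\<close>

definition hsym_int :: "(nat \<Rightarrow> 'a::comm_ring_1) \<Rightarrow> nat \<Rightarrow> int \<Rightarrow> 'a" where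
  "hsym_int x N n = (if n < 0 then 0 else hsym x N (nat n))"

text \<open>
  The coefficient of \<open>t ^ j\<close> is, up to sign, the \<open>j\<close>-th elementary symmetric polynomial in all
  variables but \<open>x\<^sub>k\<close>.
\<close>

definition omit_poly :: "(nat \<Rightarrow> 'a::comm_ring_1) \<Rightarrow> nat \<Rightarrow> nat \<Rightarrow> 'a poly" where
  "omit_poly x N k = (\<Prod>i\<in>{..<N} - {k}. [:1, - x i:])"

lemma degree_omit_poly:
  assumes "k < N"
  shows "degree (omit_poly x N k) < N"
proof -
  have "degree (omit_poly x N k) \<le> (\<Sum>i\<in>{..<N} - {k}. degree [:1, - x i:])"
    unfolding omit_poly_def using degree_prod_sum_le[of "{..<N} - {k}" "\<lambda>i. [:1, - x i:]"]
    by (simp add: o_def)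
  also have "\<dots> \<le> (\<Sum>i\<in>{..<N} - {k}. 1)" by (intro sum_mono) simp
  also have "\<dots> < N" using assms by simp
  finally show ?thesis .
qed

text \<open>
  Multiplying the generating function of the \<open>h\<^sub>n\<close> by all factors \<open>1 - x\<^sub>i t\<close> with \<open>i \<noteq> k\<close> leaves
  \<open>1 / (1 - x\<^sub>k t)\<close>, whose coefficients are the powers of \<open>x\<^sub>k\<close>. The degree bound on the product makes
  the convolution a sum over \<open>N\<close> terms for every \<open>n\<close>, so that it can be read as an entry of a matrix
  product.
\<close>

lemma power_eq_sum_hsym:
  fixes x :: "nat \<Rightarrow> 'a::comm_ring_1"
  assumes k: "k < N"
  shows "x k ^ n = (\<Sum>j<N. hsym_int x N (int n - int j) * coeff (omit_poly x N k) j)"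
proof -
  let ?H = "Abs_fps (hsym x N)" and ?E = "fps_of_poly (omit_poly x N k)"
  let ?L = "\<lambda>i. 1 - fps_const (x i) * fps_X" and ?G = "Abs_fps (\<lambda>n. x k ^ n)"
  have "?E = (\<Prod>i\<in>{..<N} - {k}. ?L i)"
    unfolding omit_poly_def fps_of_poly_prod
    by (intro prod.cong) (simp_all add: fps_of_poly_pCons)
  then have "?H * ?E * ?L k = ?H * (\<Prod>i<N. ?L i)"
    using k by (simp add: prod.remove[of "{..<N}" k] mult_ac)
  then have HEL: "?H * ?E * ?L k = 1" by (simp only: hsym_generating_function)
  have "?H * ?E = (?H * ?E) * (?G * ?L k)" by (simp only: geometric_fps mult.right_neutral)
  also have "\<dots> = (?H * ?E * ?L k) * ?G" by (simp only: mult_ac)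
  also have "\<dots> = ?G" by (simp only: HEL mult.left_neutral)
  finally have "?H * ?E = ?G" .
  then have "x k ^ n = fps_nth (?E * ?H) n" by (simp add: mult.commute)
  also have "\<dots> = (\<Sum>j\<in>{0..n}. hsym_int x N (int n - int j) * coeff (omit_poly x N k) j)"
    unfolding fps_mult_nth by (intro sum.cong) (auto simp: hsym_int_def nat_diff_distrib mult.commute)
  also have "\<dots> = (\<Sum>j\<in>{..<N} \<union> {0..n}. hsym_int x N (int n - int j) * coeff (omit_poly x N k) j)"
    by (intro sum.mono_neutral_left) (auto simp: hsym_int_def)
  also have "\<dots> = (\<Sum>j<N. hsym_int x N (int n - int j) * coeff (omit_poly x N k) j)"
  proof (intro sum.mono_neutral_right)
    have "coeff (omit_poly x N k) j = 0" if "N \<le> j" for j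
      using degree_omit_poly[OF k, of x] that by (intro coeff_eq_0) simp
    then show "\<forall>j\<in>({..<N} \<union> {0..n}) - {..<N}.
        hsym_int x N (int n - int j) * coeff (omit_poly x N k) j = 0"
      by (auto simp: not_less)
  qed auto
  finally show ?thesis .
qed

section \<open>Alternants and the Jacobi-Trudi determinant\<close>

definition alternant :: "(nat \<Rightarrow> 'a::comm_ring_1) \<Rightarrow> nat \<Rightarrow> (nat \<Rightarrow> nat) \<Rightarrow> 'a" where
  "alternant x N \<gamma> = det (mat N N (\<lambda>(i, k). x k ^ \<gamma> i))"

definition staircase :: "nat \<Rightarrow> nat \<Rightarrow> nat" where
  "staircase N i = N - 1 - i"

definition jacobi_trudi :: "(nat \<Rightarrow> 'a::comm_ring_1) \<Rightarrow> nat \<Rightarrow> (nat \<Rightarrow> nat) \<Rightarrow> 'a" where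
  "jacobi_trudi x N \<kappa> = det (mat N N (\<lambda>(i, j). hsym_int x N (int (\<kappa> i) - int i + int j)))"

text \<open>
  Below the first row the matrix has ones on the diagonal and zeros to the left of it.
\<close>

lemma jacobi_trudi_row:
  fixes x :: "nat \<Rightarrow> 'a::comm_ring_1"
  assumes row: "\<And>j. 0 < j \<Longrightarrow> j < N \<Longrightarrow> \<kappa> j = 0" and N: "0 < N"
  shows "jacobi_trudi x N \<kappa> = hsym x N (\<kappa> 0)"
proof -
  let ?A = "mat N N (\<lambda>(i, j). hsym_int x N (int (\<kappa> i) - int i + int j))"
  have "jacobi_trudi x N \<kappa> = prod_list (diag_mat ?A)"
    unfolding jacobi_trudi_def
    by (rule det_upper_triangular[of _ N]) (auto simp: upper_triangular_def row hsym_int_def)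
  also have "\<dots> = (\<Prod>i\<in>{0..<N}. ?A $$ (i, i))" by (simp add: prod_list_diag_prod)
  also have "\<dots> = hsym x N (\<kappa> 0) * (\<Prod>i\<in>{0..<N} - {0}. ?A $$ (i, i))"
    using N by (subst prod.remove[of _ 0]) (auto simp: hsym_int_def)
  also have "(\<Prod>i\<in>{0..<N} - {0}. ?A $$ (i, i)) = 1"
    by (intro prod.neutral) (auto simp: row hsym_int_def hsym_degree_0)
  finally show ?thesis by simp
qed

text \<open>
  The expression of \<open>x\<^sub>k ^ n\<close> through the \<open>h\<^sub>n\<close> factors the matrix of an alternant as the
  Jacobi-Trudi matrix times a matrix \<open>E\<close> that does not depend on \<open>\<kappa>\<close>. The case \<open>\<kappa> = 0\<close> identifies
  \<open>det E\<close> with the Vandermonde determinant.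
\<close>

lemma alternant_eq_jacobi_trudi:
  fixes x :: "nat \<Rightarrow> 'a::comm_ring_1"
  shows "alternant x N (\<lambda>i. \<kappa> i + staircase N i)
    = jacobi_trudi x N \<kappa> * alternant x N (staircase N)"
proof -
  let ?E = "mat N N (\<lambda>(j, k). coeff (omit_poly x N k) (N - 1 - j))"
  have fac: "alternant x N (\<lambda>i. \<kappa> i + staircase N i) = jacobi_trudi x N \<kappa> * det ?E" for \<kappa>
  proof -
    let ?H = "mat N N (\<lambda>(i, j). hsym_int x N (int (\<kappa> i) - int i + int j))"
    have "mat N N (\<lambda>(i, k). x k ^ (\<kappa> i + staircase N i)) = ?H * ?E"
    proof (rule eq_matI)
      fix i k assume "i < dim_row (?H * ?E)" "k < dim_col (?H * ?E)"
      then have ik: "i < N" "k < N" by auto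
      have "x k ^ (\<kappa> i + staircase N i) = (\<Sum>j<N. hsym_int x N (int (\<kappa> i + staircase N i) - int j)
          * coeff (omit_poly x N k) j)"
        by (rule power_eq_sum_hsym[OF ik(2)])
      \<comment> \<open>Reversing the summation makes the column index of the Jacobi-Trudi matrix increase.\<close>
      also have "\<dots> = (\<Sum>j<N. hsym_int x N (int (\<kappa> i + staircase N i) - int (N - Suc j))
          * coeff (omit_poly x N k) (N - Suc j))"
        by (rule sum.nat_diff_reindex[symmetric])
      also have "\<dots> = (\<Sum>j<N. ?H $$ (i, j) * ?E $$ (j, k))"
        using ik by (intro sum.cong) (auto simp: staircase_def of_nat_diff algebra_simps)
      also have "\<dots> = (?H * ?E) $$ (i, k)"
        using ik by (simp add: scalar_prod_def atLeast0LessThan)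
      finally show "mat N N (\<lambda>(i, k). x k ^ (\<kappa> i + staircase N i)) $$ (i, k) = (?H * ?E) $$ (i, k)"
        using ik by simp
    qed auto
    then show ?thesis
      unfolding alternant_def jacobi_trudi_def by (simp add: det_mult[of _ N])
  qed
  have "alternant x N (staircase N) = det ?E"
  proof (cases "N = 0")
    case True
    then show ?thesis by (simp add: alternant_def)
  next
    case False
    then show ?thesis
      using fac[of "\<lambda>_. 0"] by (simp add: jacobi_trudi_row hsym_degree_0)
  qed
  with fac show ?thesis by simp
qed

lemma alternant_sum:
  "alternant x N \<gamma> = (\<Sum>p | p permutes {..<N}. signof p * (\<Prod>i<N. x i ^ \<gamma> (p i)))"
proof -
  have "alternant x N \<gamma> = det (mat N N (\<lambda>(k, i). x k ^ \<gamma> i))"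
    unfolding alternant_def
    by (subst det_transpose[symmetric, of _ N]) (auto intro!: arg_cong[where f = det] eq_matI)
  also have "\<dots> = (\<Sum>p | p permutes {..<N}. signof p * (\<Prod>i<N. x i ^ \<gamma> (p i)))"
    unfolding det_def
    by (auto simp: atLeast0LessThan permutes_in_image intro!: sum.cong prod.cong
        arg_cong2[where f = "(*)"] dest: permutes_in_image)
  finally show ?thesis .
qed

lemma alternant_add_const:
  "alternant x N (\<lambda>i. \<gamma> i + c) = (\<Prod>i<N. x i) ^ c * alternant x N \<gamma>"
  unfolding alternant_sum sum_distrib_left
  by (intro sum.cong) (simp_all add: power_add prod.distrib prod_power_distrib mult_ac)

lemma alternant_swap:
  assumes "i < N" "j < N" "i \<noteq> j"
  shows "alternant x N (\<gamma> \<circ> Transposition.transpose i j) = - alternant x N \<gamma>"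
proof -
  let ?p = "Transposition.transpose i j" and ?A = "mat N N (\<lambda>(i, k). x k ^ \<gamma> i)"
  have p: "?p permutes {0..<N}" using assms by (intro permutes_swap_id) auto
  have "alternant x N (\<gamma> \<circ> ?p) = det (mat N N (\<lambda>(i, k). ?A $$ (?p i, k)))"
    unfolding alternant_def using permutes_in_image[OF p]
    by (intro arg_cong[where f = det] eq_matI) auto
  also have "\<dots> = signof ?p * det ?A"
    by (rule det_permute_rows[OF _ p]) simp
  finally show ?thesis
    using assms by (simp add: alternant_def sign_swap_id)
qed

text \<open>
  As \<open>h\<^sub>m\<close> is symmetric, it may be written with permuted variables in each term of the Leibniz
  expansion of the alternant, so that its monomials multiply the corresponding powers.
\<close>

lemma alternant_mult_hsym:
  "alternant x N \<alpha> * hsym x N m = (\<Sum>\<beta>\<in>compositions N m. alternant x N (\<lambda>i. \<alpha> i + \<beta> i))"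
proof -
  have perm: "(\<Sum>\<beta>\<in>compositions N m. \<Prod>i<N. x i ^ \<beta> (p i)) = hsym x N m" if p: "p permutes {..<N}" for p
    unfolding hsym_def
  proof (rule sum.reindex_bij_witness[of _ "\<lambda>\<beta>. \<beta> \<circ> inv_into UNIV p" "\<lambda>\<beta>. \<beta> \<circ> p"])
    show "\<beta> \<circ> p \<in> compositions N m" "\<beta> \<circ> inv_into UNIV p \<in> compositions N m"
      if "\<beta> \<in> compositions N m" for \<beta>
      using that p by (simp_all add: compositions_permute permutes_inv)
    show "\<beta> \<circ> p \<circ> inv_into UNIV p = \<beta>" "\<beta> \<circ> inv_into UNIV p \<circ> p = \<beta>" for \<beta> :: "nat \<Rightarrow> nat"
      using p by (simp_all add: comp_assoc permutes_inv_o)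
  qed simp
  have "(\<Sum>\<beta>\<in>compositions N m. alternant x N (\<lambda>i. \<alpha> i + \<beta> i))
      = (\<Sum>p | p permutes {..<N}. \<Sum>\<beta>\<in>compositions N m.
          signof p * (\<Prod>i<N. x i ^ \<alpha> (p i)) * (\<Prod>i<N. x i ^ \<beta> (p i)))"
    unfolding alternant_sum
    by (subst sum.swap) (simp add: power_add prod.distrib mult_ac)
  also have "\<dots> = (\<Sum>p | p permutes {..<N}. signof p * (\<Prod>i<N. x i ^ \<alpha> (p i)) * hsym x N m)"
    by (intro sum.cong) (auto simp: sum_distrib_left[symmetric] perm)
  finally show ?thesis by (simp add: alternant_sum sum_distrib_right)
qed

text \<open>
  For \<open>\<alpha> = \<kappa> + \<delta>\<close> with \<open>\<delta>\<close> the staircase, \<open>\<alpha>\<^bsub>i+1\<^esub> + \<beta>\<^bsub>i+1\<^esub> < \<alpha>\<^sub>i\<close> says that row \<open>i + 1\<close> of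
  \<open>\<kappa> + \<beta>\<close> is no longer than row \<open>i\<close> of \<open>\<kappa>\<close>.
\<close>

definition horizontal_strips :: "nat \<Rightarrow> nat \<Rightarrow> (nat \<Rightarrow> nat) \<Rightarrow> (nat \<Rightarrow> nat) set" where
  "horizontal_strips N m \<alpha> = {\<beta> \<in> compositions N m. \<forall>i. Suc i < N \<longrightarrow> \<alpha> (Suc i) + \<beta> (Suc i) < \<alpha> i}"

text \<open>
  In the sum over all \<open>\<beta>\<close>, those violating the strip condition cancel in pairs. Let \<open>i\<close> be the last
  index where the condition fails for \<open>\<gamma> = \<alpha> + \<beta>\<close>, that is \<open>\<gamma>\<^bsub>i+1\<^esub> \<ge> \<alpha>\<^sub>i\<close>, and exchange \<open>\<gamma>\<^sub>i\<close> and
  \<open>\<gamma>\<^bsub>i+1\<^esub>\<close>. Both are at least \<open>\<alpha>\<^sub>i\<close>, hence the result is again of the form \<open>\<alpha> + \<beta>'\<close> and fails at \<open>i\<close>;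
  the condition at later indices involves only later entries of \<open>\<gamma>\<close>, so \<open>i\<close> remains the last failure
  and the exchange is an involution. It changes the sign of the alternant.
\<close>

lemma alternant_pieri:
  fixes x :: "nat \<Rightarrow> 'a::{idom, ring_char_0}"
  assumes dec: "\<And>i. Suc i < N \<Longrightarrow> \<alpha> (Suc i) < \<alpha> i"
  shows "alternant x N \<alpha> * hsym x N m = (\<Sum>\<beta>\<in>horizontal_strips N m \<alpha>. alternant x N (\<lambda>i. \<alpha> i + \<beta> i))"
proof -
  define bad where "bad \<beta> = {i. Suc i < N \<and> \<alpha> i \<le> \<alpha> (Suc i) + \<beta> (Suc i)}" for \<beta>
  \<comment> \<open>The map \<open>\<phi>\<close> acts on \<open>\<alpha> + \<beta>\<close> as the exchange of two neighbouring entries.\<close>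
  define \<phi> where "\<phi> \<beta> = (let i = Max (bad \<beta>) in
      \<beta>(i := \<alpha> (Suc i) + \<beta> (Suc i) - \<alpha> i, Suc i := \<alpha> i + \<beta> i - \<alpha> (Suc i)))" for \<beta>
  have fin: "finite (bad \<beta>)" for \<beta>
    by (rule finite_subset[of _ "{..<N}"]) (auto simp: bad_def)
  let ?B = "{\<beta> \<in> compositions N m. bad \<beta> \<noteq> {}}"
  have props: "\<phi> \<beta> \<in> ?B \<and> \<phi> (\<phi> \<beta>) = \<beta> \<and>
      alternant x N (\<lambda>i. \<alpha> i + \<phi> \<beta> i) = - alternant x N (\<lambda>i. \<alpha> i + \<beta> i)"
    if \<beta>: "\<beta> \<in> ?B" for \<beta>
  proof -
    define i where "i = Max (bad \<beta>)"
    have i: "Suc i < N" "\<alpha> i \<le> \<alpha> (Suc i) + \<beta> (Suc i)"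
      using Max_in[OF fin, of \<beta>] \<beta> by (auto simp: i_def bad_def)
    have above: "j \<le> i" if "j \<in> bad \<beta>" for j
      using Max_ge[OF fin that] by (simp add: i_def)
    have phi: "\<phi> \<beta> = \<beta>(i := \<alpha> (Suc i) + \<beta> (Suc i) - \<alpha> i, Suc i := \<alpha> i + \<beta> i - \<alpha> (Suc i))"
      by (simp add: \<phi>_def Let_def i_def)
    have less: "\<alpha> (Suc i) < \<alpha> i" using dec i by blast
    have swap: "(\<lambda>k. \<alpha> k + \<phi> \<beta> k) = (\<lambda>k. \<alpha> k + \<beta> k) \<circ> Transposition.transpose i (Suc i)"
      using i less by (auto simp: phi fun_eq_iff transpose_def)
    have i_bad: "i \<in> bad (\<phi> \<beta>)"
      using i less by (auto simp: bad_def phi)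
    have Max': "Max (bad (\<phi> \<beta>)) = i"
    proof (rule Max_eqI[OF fin _ i_bad])
      fix j assume j: "j \<in> bad (\<phi> \<beta>)"
      show "j \<le> i"
      proof (rule ccontr)
        assume "\<not> j \<le> i"
        then have "j \<in> bad \<beta>" using j by (auto simp: bad_def phi)
        with above \<open>\<not> j \<le> i\<close> show False by blast
      qed
    qed
    have "\<phi> (\<phi> \<beta>) = \<beta>"
      unfolding \<phi>_def[of "\<phi> \<beta>"] Let_def Max' using i less by (auto simp: phi fun_eq_iff)
    moreover have "\<phi> \<beta> \<in> compositions N m"
    proof -
      have perm: "Transposition.transpose i (Suc i) permutes {..<N}"
        using i by (intro permutes_swap_id) auto
      have "(\<Sum>k<N. \<alpha> k + \<phi> \<beta> k) = (\<Sum>k<N. \<alpha> k + \<beta> k)"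
        unfolding swap using sum.permute[OF perm, of "\<lambda>k. \<alpha> k + \<beta> k"] by simp
      then have "(\<Sum>k<N. \<phi> \<beta> k) = m"
        using \<beta> by (simp add: sum.distrib compositionsD)
      moreover have "\<phi> \<beta> k = 0" if "N \<le> k" for k
        using that i \<beta> by (auto simp: phi compositionsD)
      ultimately show ?thesis by (simp add: compositions_def)
    qed
    moreover have "alternant x N (\<lambda>i. \<alpha> i + \<phi> \<beta> i) = - alternant x N (\<lambda>i. \<alpha> i + \<beta> i)"
      unfolding swap using i by (intro alternant_swap) auto
    ultimately show ?thesis using i_bad by blast
  qed
  have "(\<Sum>\<beta>\<in>?B. alternant x N (\<lambda>i. \<alpha> i + \<beta> i)) = (\<Sum>\<beta>\<in>?B. - alternant x N (\<lambda>i. \<alpha> i + \<beta> i))"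
    by (rule sum.reindex_bij_witness[of _ \<phi> \<phi>]) (use props in auto)
  then have "2 * (\<Sum>\<beta>\<in>?B. alternant x N (\<lambda>i. \<alpha> i + \<beta> i)) = 0"
    by (simp only: sum_negf mult_2) simp
  then have zero: "(\<Sum>\<beta>\<in>?B. alternant x N (\<lambda>i. \<alpha> i + \<beta> i)) = 0"
    by simp
  have "compositions N m = horizontal_strips N m \<alpha> \<union> ?B"
    by (auto simp: horizontal_strips_def bad_def not_le)
  then have "(\<Sum>\<beta>\<in>compositions N m. alternant x N (\<lambda>i. \<alpha> i + \<beta> i)) =
      (\<Sum>\<beta>\<in>horizontal_strips N m \<alpha> \<union> ?B. alternant x N (\<lambda>i. \<alpha> i + \<beta> i))" by simp
  also have "\<dots> = (\<Sum>\<beta>\<in>horizontal_strips N m \<alpha>. alternant x N (\<lambda>i. \<alpha> i + \<beta> i)) + 0"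
    unfolding zero[symmetric]
    by (intro sum.union_disjoint) (auto simp: horizontal_strips_def bad_def not_le finite_compositions)
  finally show ?thesis by (simp add: alternant_mult_hsym)
qed

section \<open>Schur polynomials in the polynomial ring\<close>

lemma poly_mapping_sum_single:
  "(\<Sum>k\<in>Poly_Mapping.keys f. Poly_Mapping.single k (Poly_Mapping.lookup f k)) = f"
proof (rule poly_mapping_eqI)
  fix k
  show "Poly_Mapping.lookup (\<Sum>k\<in>Poly_Mapping.keys f. Poly_Mapping.single k (Poly_Mapping.lookup f k)) k
      = Poly_Mapping.lookup f k"
    by (cases "k \<in> Poly_Mapping.keys f")
      (auto simp: lookup_sum lookup_single when_def in_keys_iff)
qed

lemma lookup_monomial_mult:
  fixes f :: "'a::cancel_comm_monoid_add \<Rightarrow>\<^sub>0 'b::comm_semiring_1"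
  shows "Poly_Mapping.lookup (Poly_Mapping.single a c * f) (a + b) = c * Poly_Mapping.lookup f b"
proof -
  have "Poly_Mapping.single a c * f =
      (\<Sum>k\<in>Poly_Mapping.keys f. Poly_Mapping.single (a + k) (c * Poly_Mapping.lookup f k))"
    by (subst poly_mapping_sum_single[symmetric, of f]) (simp add: sum_distrib_left mult_single)
  then show ?thesis
    by (cases "b \<in> Poly_Mapping.keys f")
      (auto simp: lookup_sum lookup_single when_def in_keys_iff)
qed

lemma lookup_const_poly_mult:
  "Poly_Mapping.lookup (const_poly q * f) \<alpha> = q * Poly_Mapping.lookup f \<alpha>"
  using lookup_monomial_mult[of 0 q f \<alpha>] by (simp add: const_poly_def)

text \<open>
  Columns of matrices start at \<open>0\<close>, whereas the variables of a symmetric polynomial are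
  \<open>x\<^sub>1, \<dots>, x\<^sub>N\<close>.
\<close>

definition var :: "nat \<Rightarrow> rat_poly" where
  "var i = Poly_Mapping.single (Poly_Mapping.single (Suc i) 1) 1"

definition exp_vec :: "nat \<Rightarrow> (nat \<Rightarrow> nat) \<Rightarrow> nat \<Rightarrow>\<^sub>0 nat" where
  "exp_vec N \<gamma> = (\<Sum>i<N. Poly_Mapping.single (Suc i) (\<gamma> i))"

lemma lookup_exp_vec:
  "Poly_Mapping.lookup (exp_vec N \<gamma>) k = (if k \<in> {1..N} then \<gamma> (k - 1) else 0)"
proof -
  have "Poly_Mapping.lookup (exp_vec N \<gamma>) k = (\<Sum>i<N. \<gamma> i when Suc i = k)"
    by (simp add: exp_vec_def lookup_sum lookup_single)
  also have "\<dots> = (if k \<in> {1..N} then \<gamma> (k - 1) else 0)"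
    by (cases k) (auto simp: when_def)
  finally show ?thesis .
qed

lemma keys_exp_vec: "Poly_Mapping.keys (exp_vec N \<gamma>) \<subseteq> {1..N}"
  by (auto simp: in_keys_iff lookup_exp_vec split: if_splits)

lemma exp_vec_eq_iff: "exp_vec N \<gamma> = exp_vec N \<gamma>' \<longleftrightarrow> (\<forall>i<N. \<gamma> i = \<gamma>' i)"
proof
  assume eq: "exp_vec N \<gamma> = exp_vec N \<gamma>'"
  show "\<forall>i<N. \<gamma> i = \<gamma>' i"
  proof (intro allI impI)
    fix i assume "i < N"
    then show "\<gamma> i = \<gamma>' i"
      using arg_cong[OF eq, of "\<lambda>a. Poly_Mapping.lookup a (Suc i)"] by (simp add: lookup_exp_vec)
  qed
qed (simp add: exp_vec_def)

lemma var_power: "var i ^ n = Poly_Mapping.single (Poly_Mapping.single (Suc i) n) 1"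
  by (induction n) (simp_all add: var_def mult_single single_add[symmetric])

lemma prod_var_power: "(\<Prod>i<N. var i ^ \<gamma> i) = Poly_Mapping.single (exp_vec N \<gamma>) 1"
  by (induction N) (simp_all add: exp_vec_def var_power mult_single)

lemma complete_sym_eq_hsym_int: "complete_sym N n = hsym_int var N n"
proof (cases "n < 0")
  case True
  then have "{\<alpha>. Poly_Mapping.keys \<alpha> \<subseteq> {1..N} \<and>
      int (\<Sum>i = 1..N. Poly_Mapping.lookup \<alpha> i) = n} = {}"
    by (auto simp del: of_nat_sum)
  with True show ?thesis by (simp only: complete_sym_def hsym_int_def sum.empty if_True)
next
  case False
  then obtain m where m: "n = int m" by (metis not_less nonneg_int_cases)
  let ?A = "{\<alpha> :: nat \<Rightarrow>\<^sub>0 nat. Poly_Mapping.keys \<alpha> \<subseteq> {1..N} \<and>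
      int (\<Sum>i = 1..N. Poly_Mapping.lookup \<alpha> i) = n}"
  let ?f = "\<lambda>\<alpha>::nat \<Rightarrow>\<^sub>0 nat. \<lambda>i. if i < N then Poly_Mapping.lookup \<alpha> (Suc i) else 0"
  have shift: "(\<Sum>i = 1..N. h i) = (\<Sum>i<N. h (Suc i))" for h :: "nat \<Rightarrow> nat"
    by (rule sum.reindex_bij_witness[of _ Suc "\<lambda>i. i - 1"]) auto
  have "(\<Sum>\<alpha>\<in>?A. Poly_Mapping.single \<alpha> 1 :: rat_poly)
      = (\<Sum>\<beta>\<in>compositions N m. Poly_Mapping.single (exp_vec N \<beta>) 1)"
  proof (rule sum.reindex_bij_witness[of _ "exp_vec N" ?f])
    fix \<alpha> assume \<alpha>: "\<alpha> \<in> ?A"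
    show eq: "exp_vec N (?f \<alpha>) = \<alpha>"
      using \<alpha> by (intro poly_mapping_eqI) (auto simp: lookup_exp_vec in_keys_iff subset_iff)
    have "(\<Sum>i = 1..N. Poly_Mapping.lookup \<alpha> i) = m"
      using \<alpha> m by (simp del: of_nat_sum)
    then show "?f \<alpha> \<in> compositions N m"
      unfolding shift by (simp add: compositions_def)
    show "Poly_Mapping.single (exp_vec N (?f \<alpha>)) 1 = (Poly_Mapping.single \<alpha> 1 :: rat_poly)"
      by (simp only: eq)
  next
    fix \<beta> assume \<beta>: "\<beta> \<in> compositions N m"
    show "?f (exp_vec N \<beta>) = \<beta>"
      using \<beta> by (auto simp: lookup_exp_vec fun_eq_iff compositionsD)
    have "(\<Sum>i = 1..N. Poly_Mapping.lookup (exp_vec N \<beta>) i) = m"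
      unfolding shift by (simp add: lookup_exp_vec compositionsD(2)[OF \<beta>])
    then show "exp_vec N \<beta> \<in> ?A"
      using keys_exp_vec[of N \<beta>] m by (simp del: of_nat_sum)
  qed
  then show ?thesis
    using m by (simp only: complete_sym_def hsym_int_def hsym_def prod_var_power) simp
qed

lemma schur_eq_jacobi_trudi: "schur N \<mu> = jacobi_trudi var N (\<lambda>i. \<mu> (Suc i))"
  by (simp add: schur_def jacobi_trudi_def complete_sym_eq_hsym_int)

lemma alternant_var:
  "alternant var N \<gamma> =
    (\<Sum>p | p permutes {..<N}. Poly_Mapping.single (exp_vec N (\<gamma> \<circ> p)) (signof p))"
  unfolding alternant_sum
proof (intro sum.cong refl)
  fix p
  have "(\<Prod>i<N. var i ^ \<gamma> (p i)) = Poly_Mapping.single (exp_vec N (\<gamma> \<circ> p)) 1"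
    using prod_var_power[where N = N and \<gamma> = "\<gamma> \<circ> p"] by simp
  then show "signof p * (\<Prod>i<N. var i ^ \<gamma> (p i)) =
      Poly_Mapping.single (exp_vec N (\<gamma> \<circ> p)) (signof p)"
    by (cases rule: sign_cases[of p]) (simp_all add: single_uminus)
qed

lemma keys_alternant:
  assumes "\<alpha> \<in> Poly_Mapping.keys (alternant var N \<gamma>)"
  obtains p where "p permutes {..<N}" "\<alpha> = exp_vec N (\<gamma> \<circ> p)"
proof -
  have "\<exists>p\<in>{p. p permutes {..<N}}.
      Poly_Mapping.lookup (Poly_Mapping.single (exp_vec N (\<gamma> \<circ> p)) (signof p :: rat)) \<alpha> \<noteq> 0"
  proof (rule ccontr)
    assume "\<not> ?thesis"
    then have "Poly_Mapping.lookup (alternant var N \<gamma>) \<alpha> = 0"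
      unfolding alternant_var lookup_sum by (intro sum.neutral) blast
    with assms show False by (simp add: in_keys_iff)
  qed
  then show thesis using that by (auto simp: lookup_single when_def split: if_splits)
qed

text \<open>
  A permutation that turns one strictly decreasing sequence into another has to be increasing.
\<close>

lemma permutes_eq_id_if_antimono:
  fixes N :: nat and \<gamma> \<eta> :: "nat \<Rightarrow> nat"
  assumes p: "p permutes {..<N}"
    and \<gamma>: "monotone_on {..<N} (<) (>) \<gamma>"
    and \<eta>: "monotone_on {..<N} (<) (>) \<eta>"
    and eq: "\<And>i. i < N \<Longrightarrow> \<gamma> (p i) = \<eta> i"
  shows "p = id"
proof (rule permutes_natset_ge[OF p], intro ballI)
  have lt: "p i < N" if "i < N" for i
    using permutes_in_image[OF p, of i] that by simp
  fix i assume "i \<in> {..<N}"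
  then have "i < N" by simp
  then show "i \<le> p i"
  proof (induction i)
    case (Suc i)
    have "\<gamma> (p (Suc i)) < \<gamma> (p i)"
      using Suc.prems monotone_onD[OF \<eta>, of i "Suc i"] by (simp add: eq)
    have "p i < p (Suc i)"
    proof (rule ccontr)
      assume "\<not> p i < p (Suc i)"
      then consider "p (Suc i) = p i" | "p (Suc i) < p i" by linarith
      then show False
      proof cases
        case 2
        then have "\<gamma> (p i) < \<gamma> (p (Suc i))"
          using Suc.prems by (intro monotone_onD[OF \<gamma>]) (auto simp: lt)
        with \<open>\<gamma> (p (Suc i)) < \<gamma> (p i)\<close> show False by simp
      qed (use \<open>\<gamma> (p (Suc i)) < \<gamma> (p i)\<close> in simp)
    qed
    with Suc show ?case by simp
  qed simp
qed

text \<open>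
  Of the exponents occurring in an alternant with decreasing \<open>\<gamma>\<close>, only \<open>\<gamma>\<close> itself is decreasing. So
  alternants are told apart by their coefficients at decreasing exponents.
\<close>

lemma lookup_alternant:
  assumes \<gamma>: "monotone_on {..<N} (<) (>) \<gamma>" and \<eta>: "monotone_on {..<N} (<) (>) \<eta>"
  shows "Poly_Mapping.lookup (alternant var N \<gamma>) (exp_vec N \<eta>) = (if \<forall>i<N. \<gamma> i = \<eta> i then 1 else 0)"
proof -
  have iff: "exp_vec N (\<gamma> \<circ> p) = exp_vec N \<eta> \<longleftrightarrow> p = id \<and> (\<forall>i<N. \<gamma> i = \<eta> i)"
    if p: "p permutes {..<N}" for p
    using permutes_eq_id_if_antimono[OF p \<gamma> \<eta>] by (auto simp: exp_vec_eq_iff)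
  have "Poly_Mapping.lookup (alternant var N \<gamma>) (exp_vec N \<eta>)
      = (\<Sum>p | p permutes {..<N}. if p = id then if \<forall>i<N. \<gamma> i = \<eta> i then 1 else 0 else 0)"
    unfolding alternant_var lookup_sum lookup_single
    by (intro sum.cong) (auto simp: when_def iff)
  also have "\<dots> = (if \<forall>i<N. \<gamma> i = \<eta> i then 1 else 0)"
    by (simp add: finite_permutations permutes_id sum.delta)
  finally show ?thesis .
qed

lemma staircase_antimono: "monotone_on {..<N} (<) (>) (staircase N)"
  by (auto simp: monotone_on_def staircase_def)

lemma alternant_staircase_nonzero: "alternant var N (staircase N) \<noteq> 0"
proof
  assume "alternant var N (staircase N) = 0"
  with lookup_alternant[OF staircase_antimono staircase_antimono, of N] show False by simp
qed

text \<open>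
  Adding \<open>c\<close> columns of length \<open>N\<close> to \<open>\<kappa>\<close> multiplies the alternant, and therefore the
  Jacobi-Trudi determinant, by \<open>(x\<^sub>1 \<cdots> x\<^sub>N) ^ c\<close>. The Vandermonde determinant can be cancelled in
  the polynomial ring since it is not zero.
\<close>

lemma jacobi_trudi_add_const:
  "jacobi_trudi var N (\<lambda>i. \<kappa> i + c) = (\<Prod>i<N. var i) ^ c * jacobi_trudi var N \<kappa>"
proof -
  have "jacobi_trudi var N (\<lambda>i. \<kappa> i + c) * alternant var N (staircase N)
      = alternant var N (\<lambda>i. (\<kappa> i + staircase N i) + c)"
    by (subst alternant_eq_jacobi_trudi[symmetric]) (simp add: add_ac)
  also have "\<dots> = (\<Prod>i<N. var i) ^ c * jacobi_trudi var N \<kappa> * alternant var N (staircase N)"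
    by (simp only: alternant_add_const alternant_eq_jacobi_trudi mult.assoc)
  finally show ?thesis using alternant_staircase_nonzero by simp
qed

lemma jacobi_trudi_0: "jacobi_trudi x N (\<lambda>_. 0) = 1"
  by (cases "N = 0") (simp_all add: jacobi_trudi_row hsym_degree_0, simp add: jacobi_trudi_def)

lemma schur_ones: "schur N (\<lambda>_. 1) = (\<Prod>i<N. var i)"
  using jacobi_trudi_add_const[of N "\<lambda>_. 0" 1] by (simp add: schur_eq_jacobi_trudi jacobi_trudi_0)

text \<open>
  This is \<open>alternant_pieri\<close> divided by the Vandermonde determinant.
\<close>

lemma jacobi_trudi_pieri:
  assumes dec: "\<And>i. Suc i < N \<Longrightarrow> \<kappa> (Suc i) \<le> \<kappa> i"
  shows "jacobi_trudi var N \<kappa> * hsym var N m =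
    (\<Sum>\<beta>\<in>{\<beta> \<in> compositions N m. \<forall>i. Suc i < N \<longrightarrow> \<kappa> (Suc i) + \<beta> (Suc i) \<le> \<kappa> i}.
       jacobi_trudi var N (\<lambda>i. \<kappa> i + \<beta> i))" (is "_ = sum _ ?B")
proof -
  let ?\<alpha> = "\<lambda>i. \<kappa> i + staircase N i" and ?D = "alternant var N (staircase N)"
  have B: "horizontal_strips N m ?\<alpha> = ?B"
    by (fastforce simp: horizontal_strips_def staircase_def)
  have "jacobi_trudi var N \<kappa> * hsym var N m * ?D = alternant var N ?\<alpha> * hsym var N m"
    by (simp add: alternant_eq_jacobi_trudi mult_ac)
  also have "\<dots> = (\<Sum>\<beta>\<in>?B. alternant var N (\<lambda>i. ?\<alpha> i + \<beta> i))"
    unfolding B[symmetric] using dec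
    by (intro alternant_pieri) (fastforce simp: staircase_def)
  also have "\<dots> = (\<Sum>\<beta>\<in>?B. jacobi_trudi var N (\<lambda>i. \<kappa> i + \<beta> i)) * ?D"
    unfolding sum_distrib_right alternant_eq_jacobi_trudi[symmetric] by (simp add: add_ac)
  finally show ?thesis using alternant_staircase_nonzero by simp
qed

section \<open>Independence of the Schur classes\<close>

text \<open>
  Let \<open>x ^ \<alpha>\<close> be a monomial of \<open>f\<close> whose degree in \<open>x\<^sub>1\<close> is maximal. Then the monomial
  \<open>x\<^sub>1 \<cdots> x\<^sub>N x ^ \<alpha>\<close> of \<open>x\<^sub>1 \<cdots> x\<^sub>N f\<close> is not cancelled by one of \<open>f\<close>, so it occurs in \<open>F\<close>,
  although it is divisible by every variable.
\<close>

lemma multiple_of_ones_minus_1_eq_0: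
  fixes F f :: rat_poly
  assumes eq: "F = f * ((\<Prod>i<N. var i) - 1)"
    and F: "\<And>\<alpha>. \<alpha> \<in> Poly_Mapping.keys F \<Longrightarrow> \<exists>i<N. Poly_Mapping.lookup \<alpha> (Suc i) = 0"
    and N: "0 < N"
  shows "F = 0"
proof (rule ccontr)
  assume "F \<noteq> 0"
  with eq have "Poly_Mapping.keys f \<noteq> {}" by auto
  moreover define d where "d \<alpha> = (Poly_Mapping.lookup \<alpha> 1 :: nat)" for \<alpha> :: "nat \<Rightarrow>\<^sub>0 nat"
  ultimately obtain \<alpha> where \<alpha>: "\<alpha> \<in> Poly_Mapping.keys f"
      and max: "\<And>\<beta>. \<beta> \<in> Poly_Mapping.keys f \<Longrightarrow> d \<beta> \<le> d \<alpha>"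
    using Max_in[of "d ` Poly_Mapping.keys f"] Max_ge[of "d ` Poly_Mapping.keys f"]
    by (metis (no_types, lifting) finite_imageI finite_keys image_iff image_is_empty)
  let ?e = "exp_vec N (\<lambda>_. 1)"
  have "d (?e + \<alpha>) = Suc (d \<alpha>)"
    using N by (simp add: d_def lookup_add lookup_exp_vec)
  then have zero: "Poly_Mapping.lookup f (?e + \<alpha>) = 0"
    using max[of "?e + \<alpha>"] by (auto simp: in_keys_iff)
  have "F = Poly_Mapping.single ?e 1 * f - f"
    using prod_var_power[where N = N and \<gamma> = "\<lambda>_. 1"] by (simp add: eq algebra_simps)
  then have "Poly_Mapping.lookup F (?e + \<alpha>) = Poly_Mapping.lookup f \<alpha>"
    by (simp add: lookup_minus lookup_monomial_mult zero[simplified])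
  with \<alpha> have "?e + \<alpha> \<in> Poly_Mapping.keys F" by (simp add: in_keys_iff)
  from F[OF this] show False by (auto simp: lookup_add lookup_exp_vec)
qed

lemma weight_partition_Suc:
  assumes "j < N"
  shows "weight_partition N a j = Poly_Mapping.lookup a j + weight_partition N a (Suc j)"
  using assms by (simp add: weight_partition_def sum.atLeast_Suc_atMost)

lemma weight_partition_top: "0 < N \<Longrightarrow> weight_partition N a N = 0"
  by (simp add: weight_partition_def)

lemma dominant_weights_eqI:
  assumes "a \<in> dominant_weights N" "b \<in> dominant_weights N"
    and eq: "\<And>j. j \<in> {1..N - 1} \<Longrightarrow> Poly_Mapping.lookup a j = Poly_Mapping.lookup b j"
  shows "a = b"
proof (rule poly_mapping_eqI)
  fix j
  show "Poly_Mapping.lookup a j = Poly_Mapping.lookup b j"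
  proof (cases "j \<in> {1..N - 1}")
    case False
    then have "Poly_Mapping.lookup a j = 0" "Poly_Mapping.lookup b j = 0"
      using assms(1,2) unfolding dominant_weights_def by (blast dest: in_keys_iff[THEN iffD2])+
    then show ?thesis by simp
  qed (rule eq)
qed

lemma dominant_weights_eqI_partition:
  assumes "a \<in> dominant_weights N" "b \<in> dominant_weights N"
    and eq: "\<And>i. i < N \<Longrightarrow> weight_partition N a (Suc i) = weight_partition N b (Suc i)"
  shows "a = b"
proof (rule dominant_weights_eqI[OF assms(1,2)])
  fix j assume j: "j \<in> {1..N - 1}"
  then obtain i where "j = Suc i" "Suc i < N" by (cases j) auto
  then show "Poly_Mapping.lookup a j = Poly_Mapping.lookup b j"
    using eq[of i] eq[of "Suc i"] by (simp add: weight_partition_Suc[of "Suc i" N])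
qed

text \<open>
  After multiplication with the Vandermonde determinant, \<open>S\<^bsub>(\<nu>)\<^esub>\<close> becomes the alternant with
  exponents \<open>(\<nu>) + \<delta>\<close>. Its last exponent is \<open>0\<close> as \<open>\<nu>\<close> is a weight of \<open>sl\<^sub>N\<close>, so each of its monomials
  misses a variable and the combination is zero already as a polynomial. The coefficient \<open>c\<^sub>\<nu>\<close> can then
  be read off at the exponent \<open>(\<nu>) + \<delta>\<close>.
\<close>

lemma schur_independent_mod_ones:
  assumes C: "finite C" "C \<subseteq> dominant_weights N" and N: "0 < N"
    and eq: "(\<Sum>\<nu>\<in>C. const_poly (c \<nu>) * schur N (weight_partition N \<nu>)) = g * (schur N (\<lambda>_. 1) - 1)"
    and \<nu>: "\<nu> \<in> C"
  shows "c \<nu> = 0"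
proof -
  let ?D = "alternant var N (staircase N)"
  define \<gamma> where "\<gamma> \<nu> i = weight_partition N \<nu> (Suc i) + staircase N i" for \<nu> i
  have \<gamma>: "monotone_on {..<N} (<) (>) (\<gamma> \<nu>)" for \<nu>
  proof (rule monotone_onI)
    fix i j assume ij: "i \<in> {..<N}" "j \<in> {..<N}" "i < j"
    have "weight_partition N \<nu> (Suc j) \<le> weight_partition N \<nu> (Suc i)"
      unfolding weight_partition_def using ij by (intro sum_mono2) auto
    moreover have "staircase N j < staircase N i"
      using ij by (auto simp: staircase_def)
    ultimately show "\<gamma> \<nu> j < \<gamma> \<nu> i" by (simp add: \<gamma>_def)
  qed
  have \<gamma>_last: "\<gamma> \<nu> (N - 1) = 0" for \<nu>
    using N by (simp add: \<gamma>_def weight_partition_top staircase_def)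
  define F where "F = (\<Sum>\<nu>\<in>C. const_poly (c \<nu>) * alternant var N (\<gamma> \<nu>))"
  have lookup_F: "Poly_Mapping.lookup F \<alpha> = (\<Sum>\<nu>\<in>C. c \<nu> * Poly_Mapping.lookup (alternant var N (\<gamma> \<nu>)) \<alpha>)" for \<alpha>
    by (simp add: F_def lookup_sum lookup_const_poly_mult)
  have "F = (\<Sum>\<nu>\<in>C. const_poly (c \<nu>) * schur N (weight_partition N \<nu>)) * ?D"
    unfolding F_def \<gamma>_def[abs_def] alternant_eq_jacobi_trudi schur_eq_jacobi_trudi
    by (simp only: sum_distrib_right mult.assoc)
  then have "F = (g * ?D) * ((\<Prod>i<N. var i) - 1)"
    unfolding eq schur_ones by (simp only: mult_ac)
  then have "F = 0"
  proof (rule multiple_of_ones_minus_1_eq_0[OF _ _ N])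
    fix \<alpha> assume "\<alpha> \<in> Poly_Mapping.keys F"
    then have "(\<Sum>\<nu>\<in>C. c \<nu> * Poly_Mapping.lookup (alternant var N (\<gamma> \<nu>)) \<alpha>) \<noteq> 0"
      by (simp only: in_keys_iff lookup_F not_False_eq_True)
    then obtain \<nu> where "c \<nu> * Poly_Mapping.lookup (alternant var N (\<gamma> \<nu>)) \<alpha> \<noteq> 0"
      by (rule sum.not_neutral_contains_not_neutral)
    then have "\<alpha> \<in> Poly_Mapping.keys (alternant var N (\<gamma> \<nu>))"
      by (simp add: in_keys_iff)
    then obtain p where p: "p permutes {..<N}" and \<alpha>: "\<alpha> = exp_vec N (\<gamma> \<nu> \<circ> p)"
      by (rule keys_alternant)
    have "N - 1 \<in> p ` {..<N}"
      unfolding permutes_image[OF p] using N by simp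
    then obtain i where i: "i < N" "p i = N - 1" by (rule imageE) simp
    then have "Poly_Mapping.lookup \<alpha> (Suc i) = 0"
      by (simp add: \<alpha> lookup_exp_vec \<gamma>_last[simplified])
    with i show "\<exists>i<N. Poly_Mapping.lookup \<alpha> (Suc i) = 0" by blast
  qed
  then have "0 = Poly_Mapping.lookup F (exp_vec N (\<gamma> \<nu>))" by simp
  also have "\<dots> = (\<Sum>\<nu>'\<in>C. if \<nu>' = \<nu> then c \<nu> else 0)"
    unfolding lookup_F
  proof (intro sum.cong refl)
    fix \<nu>' assume "\<nu>' \<in> C"
    with C \<nu> have "(\<forall>i<N. \<gamma> \<nu>' i = \<gamma> \<nu> i) \<longleftrightarrow> \<nu>' = \<nu>"
      using dominant_weights_eqI_partition[of \<nu>' N \<nu>] by (auto simp: \<gamma>_def)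
    then show "c \<nu>' * Poly_Mapping.lookup (alternant var N (\<gamma> \<nu>')) (exp_vec N (\<gamma> \<nu>)) =
        (if \<nu>' = \<nu> then c \<nu> else 0)"
      by (simp add: lookup_alternant[OF \<gamma> \<gamma>])
  qed
  also have "\<dots> = c \<nu>" using C \<nu> by simp
  finally show ?thesis by simp
qed

section \<open>The ring of symmetric polynomials and its quotient\<close>

lemma inj_map_key:
  fixes p :: "'a \<Rightarrow> 'a"
  assumes p: "p permutes S"
  shows "inj (Poly_Mapping.map_key p :: ('a \<Rightarrow>\<^sub>0 'b::zero) \<Rightarrow> _)"
proof (rule inj_on_inverseI)
  fix a :: "'a \<Rightarrow>\<^sub>0 'b"
  show "Poly_Mapping.map_key (inv_into UNIV p) (Poly_Mapping.map_key p a) = a"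
    using permutes_inj[OF p] permutes_inj[OF permutes_inv[OF p]] permutes_inv_o(1)[OF p]
    by (simp add: map_key_compose id_def map_key_id)
qed

lemma permute_vars_single:
  assumes p: "p permutes S"
  shows "permute_vars p (Poly_Mapping.single \<alpha> c) =
    Poly_Mapping.single (Poly_Mapping.map_key (inv_into UNIV p) \<alpha>) c"
proof -
  have "Poly_Mapping.map_key p (Poly_Mapping.map_key (inv_into UNIV p) \<alpha>) = \<alpha>"
    using permutes_inj[OF p] permutes_inj[OF permutes_inv[OF p]] permutes_inv_o(2)[OF p]
    by (simp add: map_key_compose id_def map_key_id)
  then show ?thesis
    using map_key_single[OF inj_map_key[OF p], of "Poly_Mapping.map_key (inv_into UNIV p) \<alpha>" c]
    by (simp add: permute_vars_def)
qed

lemma permute_vars_0: "p permutes S \<Longrightarrow> permute_vars p 0 = 0"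
  unfolding permute_vars_def by (rule map_key_zero[OF inj_map_key])

lemma permute_vars_add: "p permutes S \<Longrightarrow> permute_vars p (f + g) = permute_vars p f + permute_vars p g"
  unfolding permute_vars_def by (rule map_key_plus[OF inj_map_key])

lemma permute_vars_sum:
  "p permutes S \<Longrightarrow> permute_vars p (\<Sum>i\<in>A. f i) = (\<Sum>i\<in>A. permute_vars p (f i))"
  by (induction A rule: infinite_finite_induct) (simp_all add: permute_vars_0 permute_vars_add)

lemma permute_vars_mult:
  assumes p: "p permutes S"
  shows "permute_vars p (f * g) = permute_vars p f * permute_vars p g"
proof -
  have split: "f * g = (\<Sum>a\<in>Poly_Mapping.keys f. \<Sum>b\<in>Poly_Mapping.keys g.
      Poly_Mapping.single a (Poly_Mapping.lookup f a) * Poly_Mapping.single b (Poly_Mapping.lookup g b))"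
    by (simp add: sum_product[symmetric] poly_mapping_sum_single)
  have "permute_vars p (Poly_Mapping.single a c * Poly_Mapping.single b d) =
      permute_vars p (Poly_Mapping.single a c) * permute_vars p (Poly_Mapping.single b d)" for a b c d
    using permutes_inj[OF permutes_inv[OF p]]
    by (simp add: mult_single permute_vars_single[OF p] map_key_plus)
  then have "permute_vars p (f * g) =
      permute_vars p (\<Sum>a\<in>Poly_Mapping.keys f. Poly_Mapping.single a (Poly_Mapping.lookup f a)) *
      permute_vars p (\<Sum>b\<in>Poly_Mapping.keys g. Poly_Mapping.single b (Poly_Mapping.lookup g b))"
    unfolding split by (simp add: permute_vars_sum[OF p] sum_product)
  then show ?thesis by (simp only: poly_mapping_sum_single)
qed

lemma sym_polysI:
  assumes "\<And>\<alpha>. \<alpha> \<in> Poly_Mapping.keys f \<Longrightarrow> Poly_Mapping.keys \<alpha> \<subseteq> {1..N}"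
    and "\<And>p. p permutes {1..N} \<Longrightarrow> permute_vars p f = f"
  shows "f \<in> sym_polys N"
  using assms by (simp add: sym_polys_def)

lemma sym_polysD:
  assumes "f \<in> sym_polys N"
  shows "\<alpha> \<in> Poly_Mapping.keys f \<Longrightarrow> Poly_Mapping.keys \<alpha> \<subseteq> {1..N}"
    and "p permutes {1..N} \<Longrightarrow> permute_vars p f = f"
  using assms by (simp_all add: sym_polys_def)

lemma sym_polys_const: "const_poly q \<in> sym_polys N"
proof (rule sym_polysI)
  fix p assume p: "p permutes {1..N}"
  have "Poly_Mapping.map_key (inv_into UNIV p) 0 = (0 :: nat \<Rightarrow>\<^sub>0 nat)"
    by (rule map_key_zero[OF permutes_inj[OF permutes_inv[OF p]]])
  then show "permute_vars p (const_poly q) = const_poly q"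
    by (simp add: const_poly_def permute_vars_single[OF p])
qed (auto simp: const_poly_def split: if_splits)

lemma sym_polys_0: "0 \<in> sym_polys N" and sym_polys_1: "1 \<in> sym_polys N"
  using sym_polys_const[of 0 N] sym_polys_const[of 1 N] by (simp_all add: const_poly_def)

lemma sym_polys_add:
  assumes "f \<in> sym_polys N" "g \<in> sym_polys N"
  shows "f + g \<in> sym_polys N"
proof (rule sym_polysI)
  fix \<alpha> assume "\<alpha> \<in> Poly_Mapping.keys (f + g)"
  then show "Poly_Mapping.keys \<alpha> \<subseteq> {1..N}"
    using keys_add[of f g] sym_polysD(1)[OF assms(1)] sym_polysD(1)[OF assms(2)] by blast
qed (simp add: permute_vars_add sym_polysD(2)[OF assms(1)] sym_polysD(2)[OF assms(2)])

lemma sym_polys_mult: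
  assumes "f \<in> sym_polys N" "g \<in> sym_polys N"
  shows "f * g \<in> sym_polys N"
proof (rule sym_polysI)
  fix \<alpha> assume "\<alpha> \<in> Poly_Mapping.keys (f * g)"
  then obtain a b where "a \<in> Poly_Mapping.keys f" "b \<in> Poly_Mapping.keys g" "\<alpha> = a + b"
    using keys_mult[of f g] by blast
  then show "Poly_Mapping.keys \<alpha> \<subseteq> {1..N}"
    using keys_add[of a b] sym_polysD(1)[OF assms(1)] sym_polysD(1)[OF assms(2)] by blast
qed (simp add: permute_vars_mult sym_polysD(2)[OF assms(1)] sym_polysD(2)[OF assms(2)])

lemma sym_polys_uminus:
  assumes "f \<in> sym_polys N"
  shows "- f \<in> sym_polys N"
  using sym_polys_mult[OF sym_polys_const[of "- 1" N] assms]
  by (simp add: const_poly_def single_uminus)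

lemma sym_polys_diff: "f \<in> sym_polys N \<Longrightarrow> g \<in> sym_polys N \<Longrightarrow> f - g \<in> sym_polys N"
  using sym_polys_add[of f N "- g"] sym_polys_uminus[of g N] by simp

lemma sym_polys_sum: "(\<And>i. i \<in> A \<Longrightarrow> f i \<in> sym_polys N) \<Longrightarrow> (\<Sum>i\<in>A. f i) \<in> sym_polys N"
  by (induction A rule: infinite_finite_induct) (simp_all add: sym_polys_0 sym_polys_add)

lemma sym_polys_prod: "(\<And>i. i \<in> A \<Longrightarrow> f i \<in> sym_polys N) \<Longrightarrow> (\<Prod>i\<in>A. f i) \<in> sym_polys N"
  by (induction A rule: infinite_finite_induct) (simp_all add: sym_polys_1 sym_polys_mult)

lemma sym_polys_complete_sym: "complete_sym N n \<in> sym_polys N"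
proof (rule sym_polysI)
  let ?A = "{\<alpha> :: nat \<Rightarrow>\<^sub>0 nat. Poly_Mapping.keys \<alpha> \<subseteq> {1..N} \<and>
      int (\<Sum>i = 1..N. Poly_Mapping.lookup \<alpha> i) = n}"
  fix \<alpha> assume "\<alpha> \<in> Poly_Mapping.keys (complete_sym N n)"
  then have "Poly_Mapping.lookup (complete_sym N n) \<alpha> \<noteq> 0" by (simp add: in_keys_iff)
  then have "(\<Sum>\<beta>\<in>?A. Poly_Mapping.lookup (Poly_Mapping.single \<beta> (1::rat)) \<alpha>) \<noteq> 0"
    by (simp only: complete_sym_def lookup_sum not_False_eq_True)
  then obtain \<beta> where "\<beta> \<in> ?A" "Poly_Mapping.lookup (Poly_Mapping.single \<beta> (1::rat)) \<alpha> \<noteq> 0"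
    by (rule sum.not_neutral_contains_not_neutral)
  then show "Poly_Mapping.keys \<alpha> \<subseteq> {1..N}" by (auto simp: lookup_single when_def split: if_splits)
next
  let ?A = "{\<alpha> :: nat \<Rightarrow>\<^sub>0 nat. Poly_Mapping.keys \<alpha> \<subseteq> {1..N} \<and>
      int (\<Sum>i = 1..N. Poly_Mapping.lookup \<alpha> i) = n}"
  fix p assume p: "p permutes {1..N}"
  let ?q = "inv_into UNIV p"
  have q: "?q permutes {1..N}" by (rule permutes_inv[OF p])
  have closed: "Poly_Mapping.map_key r \<alpha> \<in> ?A" if r: "r permutes {1..N}" and \<alpha>: "\<alpha> \<in> ?A" for r \<alpha>
  proof -
    have "(\<Sum>i = 1..N. Poly_Mapping.lookup (Poly_Mapping.map_key r \<alpha>) i) =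
        (\<Sum>i = 1..N. Poly_Mapping.lookup \<alpha> i)"
      using sum.permute[OF r, of "Poly_Mapping.lookup \<alpha>"] permutes_inj[OF r]
      by (simp add: map_key.rep_eq)
    moreover have "Poly_Mapping.keys (Poly_Mapping.map_key r \<alpha>) \<subseteq> {1..N}"
      using \<alpha> permutes_in_image[OF r] by (auto simp: keys_map_key[OF permutes_inj[OF r]])
    ultimately show ?thesis using \<alpha> by (simp del: of_nat_sum)
  qed
  have "permute_vars p (complete_sym N n) =
      (\<Sum>\<alpha>\<in>?A. Poly_Mapping.single (Poly_Mapping.map_key ?q \<alpha>) 1)"
    unfolding complete_sym_def by (simp only: permute_vars_sum[OF p] permute_vars_single[OF p])
  also have "\<dots> = (\<Sum>\<alpha>\<in>?A. Poly_Mapping.single \<alpha> 1)"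
  proof (rule sum.reindex_bij_witness[of _ "Poly_Mapping.map_key p" "Poly_Mapping.map_key ?q"])
    fix \<alpha> :: "nat \<Rightarrow>\<^sub>0 nat"
    show "Poly_Mapping.map_key p (Poly_Mapping.map_key ?q \<alpha>) = \<alpha>"
      "Poly_Mapping.map_key ?q (Poly_Mapping.map_key p \<alpha>) = \<alpha>"
      using permutes_inj[OF p] permutes_inj[OF q] permutes_inv_o[OF p]
      by (simp_all add: map_key_compose id_def map_key_id)
  qed (use closed[OF p] closed[OF q] in blast)+
  finally show "permute_vars p (complete_sym N n) = complete_sym N n"
    by (simp only: complete_sym_def)
qed

lemma sym_polys_schur: "schur N \<mu> \<in> sym_polys N"
proof -
  have sgn: "signof p * f \<in> sym_polys N" if "f \<in> sym_polys N" for p :: "nat \<Rightarrow> nat" and f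
    using that by (cases rule: sign_cases[of p]) (simp_all add: sym_polys_uminus)
  then show ?thesis
    unfolding schur_def det_def
    by (auto intro!: sym_polys_sum sgn sym_polys_prod simp: sym_polys_complete_sym)
qed

lemma sym_ring_simps [simp]:
  "carrier (sym_ring N) = sym_polys N" "\<zero>\<^bsub>sym_ring N\<^esub> = 0" "\<one>\<^bsub>sym_ring N\<^esub> = 1"
  "f \<oplus>\<^bsub>sym_ring N\<^esub> g = f + g" "f \<otimes>\<^bsub>sym_ring N\<^esub> g = f * g"
  by (simp_all add: sym_ring_def)

lemma cring_sym_ring: "cring (sym_ring N)"
proof (rule cringI)
  show "abelian_group (sym_ring N)"
  proof (rule abelian_groupI)
    fix f assume f: "f \<in> carrier (sym_ring N)"
    show "\<exists>g\<in>carrier (sym_ring N). g \<oplus>\<^bsub>sym_ring N\<^esub> f = \<zero>\<^bsub>sym_ring N\<^esub>"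
      using f sym_polys_uminus[of f N] by (auto intro!: bexI[of _ "- f"])
  qed (auto simp: sym_polys_0 sym_polys_add algebra_simps)
  show "comm_monoid (sym_ring N)"
    by (rule comm_monoidI) (auto simp: sym_polys_1 sym_polys_mult algebra_simps)
qed (auto simp: algebra_simps)

lemma a_minus_sym_ring:
  assumes "f \<in> sym_polys N" "g \<in> sym_polys N"
  shows "f \<ominus>\<^bsub>sym_ring N\<^esub> g = f - g"
proof -
  interpret cring "sym_ring N" by (rule cring_sym_ring)
  have "\<ominus>\<^bsub>sym_ring N\<^esub> g = - g"
    using assms sym_polys_uminus[of g N] by (intro minus_equality) auto
  then show ?thesis by (simp add: a_minus_def)
qed

lemma ideal_sl_ideal: "ideal (sl_ideal N) (sym_ring N)"
proof -
  interpret cring "sym_ring N" by (rule cring_sym_ring)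
  show ?thesis
    unfolding sl_ideal_def
    by (rule genideal_ideal) (simp add: sym_polys_diff sym_polys_schur sym_polys_1)
qed

lemma sl_ideal_eq: "sl_ideal N = {g * (schur N (\<lambda>_. 1) - 1) | g. g \<in> sym_polys N}"
proof -
  interpret cring "sym_ring N" by (rule cring_sym_ring)
  have "schur N (\<lambda>_. 1) - 1 \<in> carrier (sym_ring N)"
    by (simp add: sym_polys_diff sym_polys_schur sym_polys_1)
  then show ?thesis
    unfolding sl_ideal_def by (simp add: cgenideal_eq_genideal[symmetric] cgenideal_def)
qed

lemma poly_class_eq_iff:
  assumes "f \<in> sym_polys N" "g \<in> sym_polys N"
  shows "poly_class N f = poly_class N g \<longleftrightarrow> f - g \<in> sl_ideal N"
proof -
  interpret cring "sym_ring N" by (rule cring_sym_ring)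
  show ?thesis
    using quotient_eq_iff_same_a_r_cos[OF ideal_sl_ideal[of N], of f g] assms
    by (simp add: poly_class_def a_minus_sym_ring)
qed

lemma ring_hom_poly_class: "ring_hom_cring (sym_ring N) (sl_ring N) (poly_class N)"
  unfolding sl_ring_def poly_class_def[abs_def]
  by (rule ideal.rcos_ring_hom_cring[OF ideal_sl_ideal cring_sym_ring])

lemma poly_class_mult:
  assumes "f \<in> sym_polys N" "g \<in> sym_polys N"
  shows "poly_class N f \<otimes>\<^bsub>sl_ring N\<^esub> poly_class N g = poly_class N (f * g)"
proof -
  interpret h: ring_hom_cring "sym_ring N" "sl_ring N" "poly_class N" by (rule ring_hom_poly_class)
  show ?thesis using h.hom_mult[of f g] assms by simp
qed

lemma poly_class_sum:
  assumes "\<And>i. i \<in> A \<Longrightarrow> f i \<in> sym_polys N" and "finite A"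
  shows "(\<Oplus>\<^bsub>sl_ring N\<^esub> i\<in>A. poly_class N (f i)) = poly_class N (\<Sum>i\<in>A. f i)"
proof -
  interpret h: ring_hom_cring "sym_ring N" "sl_ring N" "poly_class N" by (rule ring_hom_poly_class)
  show ?thesis
    using assms(2,1)
  proof (induction A rule: finite_induct)
    case empty
    then show ?case using h.hom_zero by simp
  next
    case (insert i A)
    then have "f i \<in> sym_polys N" "(\<Sum>i\<in>A. f i) \<in> sym_polys N"
      by (simp_all add: sym_polys_sum)
    then have "poly_class N (f i + (\<Sum>i\<in>A. f i)) =
        poly_class N (f i) \<oplus>\<^bsub>sl_ring N\<^esub> poly_class N (\<Sum>i\<in>A. f i)"
      using h.hom_add[of "f i" "\<Sum>i\<in>A. f i"] by simp
    moreover have "poly_class N (f j) \<in> carrier (sl_ring N)" if "j \<in> insert i A" for j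
      using h.hom_closed[of "f j"] insert.prems that by simp
    ultimately show ?case
      using insert by (simp add: Pi_def)
  qed
qed

text \<open>
  Both sides of the defining equation of an expansion are classes of ordinary polynomials.
\<close>

lemma schur_expansion_iff:
  "schur_expansion N \<mu> lam c \<longleftrightarrow> Poly_Mapping.keys c \<subseteq> dominant_weights N \<and>
    poly_class N (schur N (weight_partition N \<mu>) * schur N (weight_partition N lam)) =
    poly_class N (\<Sum>\<nu>\<in>Poly_Mapping.keys c.
      const_poly (Poly_Mapping.lookup c \<nu>) * schur N (weight_partition N \<nu>))"
  unfolding schur_expansion_def schur_class_def
  by (simp add: poly_class_mult poly_class_sum sym_polys_schur sym_polys_const sym_polys_mult)

lemma const_poly_diff: "const_poly (a - b) = const_poly a - const_poly b"
  by (simp add: const_poly_def single_diff)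

lemma const_poly_sum: "const_poly (\<Sum>i\<in>A. q i) = (\<Sum>i\<in>A. const_poly (q i))"
  by (induction A rule: infinite_finite_induct) (simp_all add: const_poly_def single_add)

lemma sum_keys_superset:
  assumes "finite K" "Poly_Mapping.keys c \<subseteq> K"
  shows "(\<Sum>\<nu>\<in>Poly_Mapping.keys c. const_poly (Poly_Mapping.lookup c \<nu>) * f \<nu>) =
    (\<Sum>\<nu>\<in>K. const_poly (Poly_Mapping.lookup c \<nu>) * f \<nu>)"
  using assms by (intro sum.mono_neutral_left) (auto simp: in_keys_iff const_poly_def)

lemma schur_expansion_unique:
  assumes N: "0 < N" and c: "schur_expansion N \<mu> lam c" and d: "schur_expansion N \<mu> lam d"
  shows "c = d"
proof (rule poly_mapping_eqI)
  fix \<nu>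
  let ?K = "Poly_Mapping.keys c \<union> Poly_Mapping.keys d"
  let ?S = "\<lambda>\<nu>. schur N (weight_partition N \<nu>)"
  let ?E = "\<lambda>c. \<Sum>\<nu>\<in>?K. const_poly (Poly_Mapping.lookup c \<nu>) * ?S \<nu>"
  have E: "?E c \<in> sym_polys N" "?E d \<in> sym_polys N"
    by (intro sym_polys_sum sym_polys_mult sym_polys_const sym_polys_schur)+
  have "poly_class N (?E c) = poly_class N (?E d)"
    using c d by (simp add: schur_expansion_iff sum_keys_superset[of ?K])
  then have "?E c - ?E d \<in> sl_ideal N" using poly_class_eq_iff[OF E] by simp
  then obtain g where "?E c - ?E d = g * (schur N (\<lambda>_. 1) - 1)" by (auto simp: sl_ideal_eq)
  then have *: "(\<Sum>\<nu>\<in>?K. const_poly (Poly_Mapping.lookup c \<nu> - Poly_Mapping.lookup d \<nu>) * ?S \<nu>) =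
      g * (schur N (\<lambda>_. 1) - 1)"
    by (simp add: const_poly_diff left_diff_distrib sum_subtractf)
  show "Poly_Mapping.lookup c \<nu> = Poly_Mapping.lookup d \<nu>"
  proof (cases "\<nu> \<in> ?K")
    case True
    have "Poly_Mapping.lookup c \<nu> - Poly_Mapping.lookup d \<nu> = 0"
      by (rule schur_independent_mod_ones[OF _ _ N * True])
        (use c d in \<open>auto simp: schur_expansion_iff\<close>)
    then show ?thesis by simp
  qed (simp add: in_keys_iff)
qed

lemma lr_coeff_eqI:
  assumes "0 < N" "schur_expansion N \<mu> lam c"
  shows "lr_coeff N \<mu> lam \<nu> = Poly_Mapping.lookup c \<nu>"
  unfolding lr_coeff_def using assms
  by (subst the_equality[of _ c]) (auto dest: schur_expansion_unique)

text \<open>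
  In the quotient \<open>S\<^bsub>(1^N)\<^esub>\<close> is the unit element.
\<close>

lemma poly_class_ones_power:
  assumes "f \<in> sym_polys N"
  shows "poly_class N (schur N (\<lambda>_. 1) ^ k * f) = poly_class N f"
proof (induction k)
  case (Suc k)
  have pow: "schur N (\<lambda>_. 1) ^ k \<in> sym_polys N" for k
    by (induction k) (simp_all add: sym_polys_1 sym_polys_mult sym_polys_schur)
  let ?e = "schur N (\<lambda>_. 1)"
  have "?e ^ Suc k * f - ?e ^ k * f = ?e ^ k * f * (?e - 1)" by (simp add: algebra_simps)
  then have "?e ^ Suc k * f - ?e ^ k * f \<in> sl_ideal N"
    using sym_polys_mult[OF pow assms, of k] by (auto simp: sl_ideal_eq)
  then have "poly_class N (?e ^ Suc k * f) = poly_class N (?e ^ k * f)"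
    using poly_class_eq_iff[OF sym_polys_mult[OF pow assms] sym_polys_mult[OF pow assms], of "Suc k" k]
    by simp
  with Suc.IH show ?case by simp
qed simp

section \<open>The coefficients of a product with a complete symmetric polynomial\<close>

text \<open>
  Here \<open>\<beta> i\<close> is the number of boxes added to row \<open>i\<close>, where the first row has index \<open>0\<close>. The bound for
  row \<open>i + 1\<close> is the difference of the lengths of rows \<open>i\<close> and \<open>i + 1\<close> of \<open>(\<mu>)\<close>, which is the coordinate
  of \<open>\<mu>\<close> at \<open>\<lambda>\<^bsub>i+1\<^esub>\<close>.
\<close>

definition pieri_strips :: "nat \<Rightarrow> nat \<Rightarrow> weight \<Rightarrow> (nat \<Rightarrow> nat) set" where
  "pieri_strips N m \<mu> =
     {\<beta> \<in> compositions N m. \<forall>i. Suc i < N \<longrightarrow> \<beta> (Suc i) \<le> Poly_Mapping.lookup \<mu> (Suc i)}"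

text \<open>
  The consecutive row differences of \<open>(\<mu>) + \<beta>\<close>. For \<open>\<beta>\<close> in \<open>pieri_strips\<close> the subtraction does not
  truncate.
\<close>

definition strip_weight :: "nat \<Rightarrow> weight \<Rightarrow> (nat \<Rightarrow> nat) \<Rightarrow> weight" where
  "strip_weight N \<mu> \<beta> =
     (\<Sum>j\<in>{1..N - 1}. Poly_Mapping.single j (Poly_Mapping.lookup \<mu> j + \<beta> (j - 1) - \<beta> j))"

lemma lookup_strip_weight:
  "Poly_Mapping.lookup (strip_weight N \<mu> \<beta>) j =
    (if j \<in> {1..N - 1} then Poly_Mapping.lookup \<mu> j + \<beta> (j - 1) - \<beta> j else 0)"
  by (auto simp: strip_weight_def lookup_sum lookup_single when_def)

lemma strip_weight_dominant: "strip_weight N \<mu> \<beta> \<in> dominant_weights N"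
  by (auto simp: dominant_weights_def in_keys_iff lookup_strip_weight split: if_splits)

text \<open>
  The differences determine \<open>(\<mu>) + \<beta>\<close> up to a constant. Since \<open>(\<mu>)\<close> has last row \<open>0\<close>, the last row
  of \<open>(\<mu>) + \<beta>\<close> is \<open>\<beta> (N - 1)\<close>, and this is the constant.
\<close>

lemma weight_partition_strip_weight:
  assumes \<beta>: "\<beta> \<in> pieri_strips N m \<mu>" and i: "i < N"
  shows "weight_partition N (strip_weight N \<mu> \<beta>) (Suc i) + \<beta> (N - 1) =
    weight_partition N \<mu> (Suc i) + \<beta> i"
proof -
  have "i \<le> N - 1" using i by simp
  then show ?thesis
  proof (induction rule: inc_induct)
    case base
    show ?case using i by (simp add: weight_partition_top)
  next
    case (step k)
    then have "Suc k < N" by simp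
    moreover have "\<beta> (Suc k) \<le> Poly_Mapping.lookup \<mu> (Suc k)"
      using \<beta> \<open>Suc k < N\<close> by (simp add: pieri_strips_def)
    moreover have "Poly_Mapping.lookup (strip_weight N \<mu> \<beta>) (Suc k) =
        Poly_Mapping.lookup \<mu> (Suc k) + \<beta> k - \<beta> (Suc k)"
      using \<open>Suc k < N\<close> by (auto simp: lookup_strip_weight)
    ultimately show ?case
      using step.IH by (simp add: weight_partition_Suc[of "Suc k" N])
  qed
qed

lemma schur_first_fundamental:
  assumes N: "2 \<le> N"
  shows "schur N (weight_partition N (Poly_Mapping.single 1 m)) = hsym var N m"
proof -
  have wp: "weight_partition N (Poly_Mapping.single 1 m) (Suc i) = (if i = 0 then m else 0)" for i
    using N by (auto simp: weight_partition_def lookup_single when_def)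
  show ?thesis
    using N by (simp add: schur_eq_jacobi_trudi wp[simplified] jacobi_trudi_row)
qed

lemma finite_pieri_strips: "finite (pieri_strips N m \<mu>)"
  by (rule finite_subset[OF _ finite_compositions]) (auto simp: pieri_strips_def)

text \<open>
  Pieri's rule with every partition reduced to the one of its weight: the full columns split off
  as a power of \<open>S\<^bsub>(1^N)\<^esub>\<close>.
\<close>

lemma poly_class_pieri:
  assumes N: "2 \<le> N"
  shows "poly_class N (schur N (weight_partition N \<mu>) * schur N (weight_partition N (Poly_Mapping.single 1 m))) =
    poly_class N (\<Sum>\<beta>\<in>pieri_strips N m \<mu>. schur N (weight_partition N (strip_weight N \<mu> \<beta>)))"
proof -
  let ?\<kappa> = "\<lambda>i. weight_partition N \<mu> (Suc i)" and ?B = "pieri_strips N m \<mu>"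
  let ?S = "\<lambda>\<beta>. schur N (weight_partition N (strip_weight N \<mu> \<beta>))"
  let ?e = "schur N (\<lambda>_. 1)"
  have B: "?B = {\<beta> \<in> compositions N m. \<forall>i. Suc i < N \<longrightarrow> ?\<kappa> (Suc i) + \<beta> (Suc i) \<le> ?\<kappa> i}"
    by (auto simp: pieri_strips_def weight_partition_Suc)
  have "schur N (weight_partition N \<mu>) * schur N (weight_partition N (Poly_Mapping.single 1 m)) =
      jacobi_trudi var N ?\<kappa> * hsym var N m"
    by (subst schur_first_fundamental[OF N]) (simp only: schur_eq_jacobi_trudi)
  also have "\<dots> = (\<Sum>\<beta>\<in>?B. jacobi_trudi var N (\<lambda>i. ?\<kappa> i + \<beta> i))"
    unfolding B by (rule jacobi_trudi_pieri) (simp add: weight_partition_Suc)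
  also have "\<dots> = (\<Sum>\<beta>\<in>?B. ?e ^ \<beta> (N - 1) * ?S \<beta>)"
  proof (rule sum.cong[OF refl])
    fix \<beta> assume \<beta>: "\<beta> \<in> ?B"
    have "jacobi_trudi var N (\<lambda>i. ?\<kappa> i + \<beta> i) =
        jacobi_trudi var N (\<lambda>i. weight_partition N (strip_weight N \<mu> \<beta>) (Suc i) + \<beta> (N - 1))"
      unfolding jacobi_trudi_def
      by (intro arg_cong[where f = det] eq_matI)
        (auto simp: weight_partition_strip_weight[OF \<beta>, simplified] simp flip: of_nat_add)
    also have "\<dots> = ?e ^ \<beta> (N - 1) * ?S \<beta>"
      by (simp only: jacobi_trudi_add_const schur_ones schur_eq_jacobi_trudi[of N "weight_partition _ _"])
    finally show "jacobi_trudi var N (\<lambda>i. ?\<kappa> i + \<beta> i) = ?e ^ \<beta> (N - 1) * ?S \<beta>" .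
  qed
  finally have "poly_class N (schur N (weight_partition N \<mu>) *
      schur N (weight_partition N (Poly_Mapping.single 1 m))) =
      poly_class N (\<Sum>\<beta>\<in>?B. ?e ^ \<beta> (N - 1) * ?S \<beta>)" by (rule arg_cong)
  also have "\<dots> = (\<Oplus>\<^bsub>sl_ring N\<^esub> \<beta>\<in>?B. poly_class N (?e ^ \<beta> (N - 1) * ?S \<beta>))"
  proof (rule poly_class_sum[symmetric, OF _ finite_pieri_strips])
    have "?e ^ k \<in> sym_polys N" for k
      by (induction k) (simp_all add: sym_polys_1 sym_polys_mult sym_polys_schur)
    then show "?e ^ \<beta> (N - 1) * ?S \<beta> \<in> sym_polys N" for \<beta>
      by (simp add: sym_polys_mult sym_polys_schur)
  qed
  also have "\<dots> = (\<Oplus>\<^bsub>sl_ring N\<^esub> \<beta>\<in>?B. poly_class N (?S \<beta>))"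
    by (simp only: poly_class_ones_power sym_polys_schur)
  also have "\<dots> = poly_class N (\<Sum>\<beta>\<in>?B. ?S \<beta>)"
    by (rule poly_class_sum[OF _ finite_pieri_strips]) (simp add: sym_polys_schur)
  finally show ?thesis .
qed

text \<open>
  Collecting equal weights in Pieri's rule gives an expansion, and expansions are unique.
\<close>

theorem lr_coeff_eq_card_pieri_strips:
  assumes N: "2 \<le> N"
  shows "lr_coeff N \<mu> (Poly_Mapping.single 1 m) \<nu> =
    of_nat (card {\<beta> \<in> pieri_strips N m \<mu>. strip_weight N \<mu> \<beta> = \<nu>})"
proof -
  let ?B = "pieri_strips N m \<mu>" and ?w = "strip_weight N \<mu>"
  let ?S = "\<lambda>\<nu>. schur N (weight_partition N \<nu>)"
  define c :: "weight \<Rightarrow>\<^sub>0 rat" where "c = (\<Sum>\<beta>\<in>?B. Poly_Mapping.single (?w \<beta>) 1)"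
  have lookup_c: "Poly_Mapping.lookup c \<nu> = (\<Sum>\<beta>\<in>?B. 1 when ?w \<beta> = \<nu>)" for \<nu>
    by (simp add: c_def lookup_sum lookup_single)
  have keys_c: "Poly_Mapping.keys c \<subseteq> ?w ` ?B"
  proof
    fix \<nu> assume "\<nu> \<in> Poly_Mapping.keys c"
    then have "(\<Sum>\<beta>\<in>?B. (1::rat) when ?w \<beta> = \<nu>) \<noteq> 0"
      by (simp only: in_keys_iff lookup_c not_False_eq_True)
    then obtain \<beta> where "\<beta> \<in> ?B" "((1::rat) when ?w \<beta> = \<nu>) \<noteq> 0"
      by (rule sum.not_neutral_contains_not_neutral)
    then show "\<nu> \<in> ?w ` ?B" by (auto simp: when_def split: if_splits)
  qed
  have const: "const_poly (\<Sum>\<beta>\<in>?B. 1 when ?w \<beta> = \<nu>) = (\<Sum>\<beta>\<in>?B. 1 when ?w \<beta> = \<nu>)" for \<nu>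
    unfolding const_poly_sum by (intro sum.cong) (auto simp: when_def const_poly_def)
  have "(\<Sum>\<nu>\<in>Poly_Mapping.keys c. const_poly (Poly_Mapping.lookup c \<nu>) * ?S \<nu>) =
      (\<Sum>\<nu>\<in>?w ` ?B. const_poly (Poly_Mapping.lookup c \<nu>) * ?S \<nu>)"
    by (rule sum_keys_superset[OF finite_imageI[OF finite_pieri_strips] keys_c])
  also have "\<dots> = (\<Sum>\<nu>\<in>?w ` ?B. \<Sum>\<beta>\<in>?B. if \<nu> = ?w \<beta> then ?S \<nu> else 0)"
    unfolding lookup_c const sum_distrib_right by (intro sum.cong) (auto simp: when_def)
  also have "\<dots> = (\<Sum>\<beta>\<in>?B. ?S (?w \<beta>))"
    by (subst sum.swap) (auto simp: finite_pieri_strips intro!: sum.cong)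
  finally have "schur_expansion N \<mu> (Poly_Mapping.single 1 m) c"
    using poly_class_pieri[OF N, of \<mu> m] keys_c strip_weight_dominant[of N \<mu>]
    unfolding schur_expansion_iff by auto
  then have "lr_coeff N \<mu> (Poly_Mapping.single 1 m) \<nu> = Poly_Mapping.lookup c \<nu>"
    using N by (intro lr_coeff_eqI) auto
  also have "\<dots> = (\<Sum>\<beta>\<in>{\<beta> \<in> ?B. ?w \<beta> = \<nu>}. 1)"
    by (simp only: lookup_c when_def sum.inter_filter[OF finite_pieri_strips])
  finally show ?thesis by simp
qed

section \<open>Orbits of sum triples\<close>

lemma card_fibre_comp_permutation:
  assumes "permutation p"
  shows "card {i. f (p i) = v} = card {i. f i = v}"
proof -
  have "bij p" by (rule permutation_bijective[OF assms])
  then have "card (p -` {i. f i = v}) = card {i. f i = v}"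
    by (intro card_vimage_inj) (auto simp: bij_def)
  then show ?thesis by (simp add: vimage_def)
qed

text \<open>
  Outside a finite set both sequences are constantly \<open>d\<close>. On such a set the multisets of their
  values agree: the multiplicity of \<open>d\<close> is what is left from the common number of positions.
\<close>

lemma ex_permutation_if_card_fibres_eq:
  fixes f g :: "nat \<Rightarrow> 'a"
  assumes fin: "finite {i. f i \<noteq> d}" "finite {i. g i \<noteq> d}"
    and card: "\<And>v. v \<noteq> d \<Longrightarrow> card {i. f i = v} = card {i. g i = v}"
  shows "\<exists>p. permutation p \<and> f = g \<circ> p"
proof -
  define A where "A = {i. f i \<noteq> d} \<union> {i. g i \<noteq> d}"
  have A: "finite A" using fin by (simp add: A_def)
  let ?F = "image_mset f (mset_set A)" and ?G = "image_mset g (mset_set A)"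
  have count: "count ?F v = count ?G v" if "v \<noteq> d" for v
  proof -
    have "{i \<in> A. f i = v} = {i. f i = v}" "{i \<in> A. g i = v} = {i. g i = v}"
      using that by (auto simp: A_def)
    with card[OF that] show ?thesis by (simp add: count_image_mset_eq_card_vimage A)
  qed
  have other: "filter_mset (\<lambda>v. v \<noteq> d) ?F = filter_mset (\<lambda>v. v \<noteq> d) ?G"
    by (rule multiset_eqI) (simp add: count)
  have "size M = size (filter_mset (\<lambda>v. v \<noteq> d) M) + count M d" for M
    using arg_cong[OF multiset_partition[of M "\<lambda>v. v \<noteq> d"], of size]
    by (simp add: filter_eq_replicate_mset)
  from this[of ?F] this[of ?G] have "count ?F d = count ?G d"
    unfolding other by simp
  with count have "?F = ?G" by (metis multiset_eqI)
  then obtain p where p: "p permutes A" and fg: "\<forall>i\<in>A. f i = g (p i)"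
    by (rule image_mset_eq_implies_permutes[OF A])
  have "f i = g (p i)" for i
  proof (cases "i \<in> A")
    case False
    then show ?thesis using permutes_not_in[OF p False] by (simp add: A_def)
  qed (use fg in simp)
  moreover have "permutation p" using p A by (auto simp: permutation_permutes)
  ultimately show ?thesis by (auto simp: fun_eq_iff)
qed

lemma seq_act_inv_into: "permutation p \<Longrightarrow> seq_act (inv_into UNIV p) x = x \<circ> p"
  by (simp add: seq_act_def inv_inv_eq permutation_bijective)

lemma orbit_seq_act: "orbit S_inf seq_act x = {x \<circ> p | p. permutation p}"
  unfolding orbit_def S_inf_def
  by (auto, metis seq_act_def permutation_inverse, metis seq_act_inv_into permutation_inverse)

lemma orbit_diag_act: "orbit S_inf diag_act (x, y, z) = {(x \<circ> p, y \<circ> p, z \<circ> p) | p. permutation p}"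
  unfolding orbit_def S_inf_def diag_act_def
  by (auto, metis seq_act_def permutation_inverse, metis seq_act_inv_into permutation_inverse)

text \<open>
  Orbits are given by all finitary permutations, which form a group, so equality of orbits is
  equivalent to one being reachable from the other.
\<close>

lemma orbit_diag_act_eq_iff:
  "orbit S_inf diag_act (x, y, z) = orbit S_inf diag_act (x', y', z') \<longleftrightarrow>
    (\<exists>p. permutation p \<and> x = x' \<circ> p \<and> y = y' \<circ> p \<and> z = z' \<circ> p)" (is "?l \<longleftrightarrow> ?r")
proof
  have "(x, y, z) \<in> orbit S_inf diag_act (x, y, z)"
    unfolding orbit_diag_act using permutation_id by (auto simp: fun_eq_iff intro!: exI[of _ id])
  moreover assume ?l
  ultimately show ?r unfolding orbit_diag_act by auto
next
  assume ?r
  then obtain p where p: "permutation p" "x = x' \<circ> p" "y = y' \<circ> p" "z = z' \<circ> p" by blast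
  let ?F = "\<lambda>q. (x' \<circ> q, y' \<circ> q, z' \<circ> q)"
  have "(\<circ>) p ` {q. permutation q} = {q. permutation q}"
    (is "_ ` ?P = _")
  proof (intro equalityI subsetI)
    fix q :: "nat \<Rightarrow> nat" assume q: "q \<in> ?P"
    have "p \<circ> inv_into UNIV p = id"
      using permutation_bijective[OF p(1)] by (simp add: surj_iff[symmetric] bij_is_surj)
    then have "q = p \<circ> (inv_into UNIV p \<circ> q)"
      by (simp add: comp_assoc[symmetric])
    moreover have "permutation (inv_into UNIV p \<circ> q)"
      using q by (intro permutation_compose permutation_inverse p(1)) simp
    ultimately show "q \<in> (\<circ>) p ` ?P" by blast
  qed (auto intro: permutation_compose p(1))
  moreover have "orbit S_inf diag_act (x, y, z) = ?F ` ((\<circ>) p ` {q. permutation q})"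
    unfolding orbit_diag_act p(2-4) comp_assoc by auto
  moreover have "orbit S_inf diag_act (x', y', z') = ?F ` {q. permutation q}"
    unfolding orbit_diag_act by auto
  ultimately show ?l by simp
qed

lemma card_weight_seq:
  assumes "v \<noteq> 0"
  shows "card {i. weight_seq N a i = v} =
    (if v \<in> {1..int N - 1} then Poly_Mapping.lookup a (nat v) else 0)"
proof -
  define xs where "xs = concat (map (\<lambda>j. replicate (Poly_Mapping.lookup a j) (int j)) (rev [1..<N]))"
  have "weight_seq N a i = (if i < length xs then xs ! i else 0)" for i
    by (simp only: weight_seq_def xs_def Let_def)
  then have "{i. weight_seq N a i = v} = {i. i < length xs \<and> xs ! i = v}"
    using assms by (auto split: if_splits)
  then have "card {i. weight_seq N a i = v} = length (filter (\<lambda>u. u = v) xs)"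
    by (simp add: length_filter_conv_card)
  also have "\<dots> = (\<Sum>j\<leftarrow>rev [1..<N]. if int j = v then Poly_Mapping.lookup a j else 0)"
    by (auto simp: xs_def filter_concat length_concat o_def intro!: arg_cong[where f = sum_list])
  also have "\<dots> = (\<Sum>j\<in>{1..<N}. if int j = v then Poly_Mapping.lookup a j else 0)"
    by (subst sum_list_distinct_conv_sum_set) auto
  also have "\<dots> = (\<Sum>j\<in>{1..<N}. if j = nat v then if v \<ge> 0 then Poly_Mapping.lookup a j else 0 else 0)"
    by (intro sum.cong) auto
  also have "\<dots> = (if v \<in> {1..int N - 1} then Poly_Mapping.lookup a (nat v) else 0)"
    using assms by auto
  finally show ?thesis .
qed

lemma finite_weight_seq: "finite {i. weight_seq N a i \<noteq> 0}"
  unfolding weight_seq_def Let_def by (rule finite_subset[OF _ finite_lessThan]) auto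

lemma weight_seq_range: "0 < N \<Longrightarrow> weight_seq N a i \<in> {0..<int N}"
proof -
  assume N: "0 < N"
  define xs where "xs = concat (map (\<lambda>j. replicate (Poly_Mapping.lookup a j) (int j)) (rev [1..<N]))"
  have "set xs \<subseteq> {0..<int N}" by (auto simp: xs_def)
  then have "i < length xs \<Longrightarrow> xs ! i \<in> {0..<int N}" using nth_mem by blast
  moreover have "weight_seq N a i = (if i < length xs then xs ! i else 0)"
    by (simp only: weight_seq_def xs_def Let_def)
  ultimately show ?thesis using N by simp
qed

text \<open>
  The multiplicities of the nonzero values determine an orbit.
\<close>

lemma weight_orbit_iff:
  assumes N: "0 < N"
  shows "x \<in> weight_orbit N a \<longleftrightarrow>
    finite {i. x i \<noteq> 0} \<and> (\<forall>i. x i \<in> {0..<int N}) \<and>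
    (\<forall>j\<in>{1..N - 1}. card {i. x i = int j} = Poly_Mapping.lookup a j)" (is "_ \<longleftrightarrow> ?r")
proof
  assume "x \<in> weight_orbit N a"
  then obtain p where p: "permutation p" and x: "x = weight_seq N a \<circ> p"
    by (auto simp: weight_orbit_def orbit_seq_act)
  have "finite (p -` {i. weight_seq N a i \<noteq> 0})"
    using permutation_bijective[OF p] finite_weight_seq by (intro finite_vimageI) (auto simp: bij_def)
  then show ?r
    using weight_seq_range[OF N, of a] by (auto simp: x card_fibre_comp_permutation[OF p] card_weight_seq vimage_def)
next
  assume x: ?r
  have "card {i. x i = v} = card {i. weight_seq N a i = v}" if v: "v \<noteq> 0" for v
  proof (cases "v \<in> {1..int N - 1}")
    case True
    then have "nat v \<in> {1..N - 1}" "int (nat v) = v" by auto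
    with x have "card {i. x i = v} = Poly_Mapping.lookup a (nat v)" by metis
    with True v show ?thesis by (simp add: card_weight_seq)
  next
    case False
    have "x i \<noteq> v" for i
    proof -
      have "x i \<in> {0..<int N}" using x by blast
      with False v show ?thesis by auto
    qed
    with False v show ?thesis by (auto simp: card_weight_seq)
  qed
  then have "\<exists>p. permutation p \<and> x = weight_seq N a \<circ> p"
    using x finite_weight_seq by (intro ex_permutation_if_card_fibres_eq[of _ 0]) auto
  then show "x \<in> weight_orbit N a"
    by (auto simp: weight_orbit_def orbit_seq_act)
qed

lemma weight_orbit_first_fundamental:
  assumes N: "2 \<le> N"
  shows "y \<in> weight_orbit N (Poly_Mapping.single 1 m) \<longleftrightarrow>
    finite {i. y i \<noteq> 0} \<and> (\<forall>i. y i \<in> {0, 1}) \<and> card {i. y i = 1} = m" (is "_ \<longleftrightarrow> ?r")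
proof
  assume "y \<in> weight_orbit N (Poly_Mapping.single 1 m)"
  then have fin: "finite {i. y i \<noteq> 0}" and range: "\<And>i. y i \<in> {0..<int N}"
    and card: "\<And>j. j \<in> {1..N - 1} \<Longrightarrow> card {i. y i = int j} = (m when 1 = j)"
    using N by (auto simp: weight_orbit_iff lookup_single)
  have "y i \<in> {0, 1}" for i
  proof (rule ccontr)
    assume "y i \<notin> {0, 1}"
    with range[of i] have "nat (y i) \<in> {1..N - 1}" "nat (y i) \<noteq> 1" "int (nat (y i)) = y i" by auto
    with card[of "nat (y i)"] have "card {k. y k = y i} = 0" by simp
    moreover have "finite {k. y k = y i}"
      by (rule finite_subset[OF _ fin]) (use \<open>y i \<notin> {0, 1}\<close> in auto)
    ultimately show False by auto
  qed
  with fin card[of 1] N show ?r by simp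
next
  assume r: ?r
  then have "y i \<in> {0..<int N}" for i using N by (cases "y i = 0") auto
  moreover have "card {i. y i = int j} = (m when 1 = j)" if "j \<in> {1..N - 1}" for j
  proof (cases "j = 1")
    case False
    have "y i \<noteq> int j" for i
    proof -
      have "y i = 0 \<or> y i = 1" using r by blast
      with False that show ?thesis by auto
    qed
    with False show ?thesis by simp
  qed (use r in simp)
  ultimately show "y \<in> weight_orbit N (Poly_Mapping.single 1 m)"
    using r N by (simp add: weight_orbit_iff lookup_single)
qed

definition overlap :: "nat \<Rightarrow> (nat \<Rightarrow> int) \<Rightarrow> (nat \<Rightarrow> int) \<Rightarrow> nat \<Rightarrow> nat" where
  "overlap N x y j = (if j < N then card {i. x i = int j \<and> y i = 1} else 0)"

lemma sum_triples_iff: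
  assumes N: "0 < N"
  shows "(x, y, z) \<in> sum_triples N A B C \<longleftrightarrow>
    x \<in> A \<and> y \<in> B \<and> z \<in> C \<and> z = (\<lambda>i. (x i + y i) mod int N)"
  using N by (auto simp: sum_triples_def seq_group_def)

context
  fixes N m :: nat and \<mu> :: weight and x y :: "nat \<Rightarrow> int"
  assumes N: "2 \<le> N"
    and x: "x \<in> weight_orbit N \<mu>"
    and y: "y \<in> weight_orbit N (Poly_Mapping.single 1 m)"
begin

lemma left_summand: "finite {i. x i \<noteq> 0}" "x i \<in> {0..<int N}"
    "j \<in> {1..N - 1} \<Longrightarrow> card {i. x i = int j} = Poly_Mapping.lookup \<mu> j"
  using x N by (auto simp: weight_orbit_iff)

lemma right_summand: "finite {i. y i \<noteq> 0}" "y i = 0 \<or> y i = 1" "card {i. y i = 1} = m"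
  using y[unfolded weight_orbit_first_fundamental[OF N]] by auto

lemma finite_overlap: "finite {i. x i = v \<and> y i = 1}"
  by (rule finite_subset[OF _ right_summand(1)]) auto

lemma finite_left_fibre: "v \<noteq> 0 \<Longrightarrow> finite {i. x i = v}"
  by (rule finite_subset[OF _ left_summand(1)]) auto

lemma overlap_le:
  assumes "j \<in> {1..N - 1}"
  shows "overlap N x y j \<le> Poly_Mapping.lookup \<mu> j"
proof -
  have "card {i. x i = int j \<and> y i = 1} \<le> card {i. x i = int j}"
    using assms by (intro card_mono finite_left_fibre) auto
  also have "\<dots> = Poly_Mapping.lookup \<mu> j" by (rule left_summand(3)[OF assms])
  finally show ?thesis by (simp add: overlap_def)
qed

lemma overlap_in_pieri_strips: "overlap N x y \<in> pieri_strips N m \<mu>"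
proof -
  have "(\<Sum>j<N. overlap N x y j) = (\<Sum>j<N. card {i. x i = int j \<and> y i = 1})"
    by (intro sum.cong) (auto simp: overlap_def)
  also have "\<dots> = card (\<Union>j<N. {i. x i = int j \<and> y i = 1})"
    by (rule card_UN_disjoint[symmetric]) (auto simp: finite_overlap)
  also have "(\<Union>j<N. {i. x i = int j \<and> y i = 1}) = {i. y i = 1}"
  proof (intro equalityI subsetI)
    fix i assume "i \<in> {i. y i = 1}"
    then show "i \<in> (\<Union>j<N. {i. x i = int j \<and> y i = 1})"
      using left_summand(2)[of i] by (auto intro!: bexI[of _ "nat (x i)"])
  qed auto
  also have "card {i. y i = 1} = m" by (rule right_summand(3))
  finally have "(\<Sum>j<N. overlap N x y j) = m" .
  moreover have "overlap N x y i = 0" if "N \<le> i" for i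
    using that by (simp add: overlap_def)
  moreover have "overlap N x y (Suc i) \<le> Poly_Mapping.lookup \<mu> (Suc i)" if "Suc i < N" for i
    using that by (intro overlap_le) simp
  ultimately show ?thesis by (simp add: pieri_strips_def compositions_def)
qed

lemma card_rest:
  assumes "j \<in> {1..N - 1}"
  shows "card {i. x i = int j \<and> y i = 0} = Poly_Mapping.lookup \<mu> j - overlap N x y j"
proof -
  have "{i. x i = int j \<and> y i = 0} = {i. x i = int j} - {i. x i = int j \<and> y i = 1}"
    using right_summand(2) by auto
  then have "card {i. x i = int j \<and> y i = 0} = card {i. x i = int j} - card {i. x i = int j \<and> y i = 1}"
    by (simp only:) (rule card_Diff_subset[OF finite_overlap], auto)
  moreover have "j < N" using assms by auto
  ultimately show ?thesis using left_summand(3)[OF assms] by (simp add: overlap_def)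
qed

text \<open>
  An entry \<open>j \<noteq> 0\<close> of the sum comes from an entry \<open>j\<close> of \<open>x\<close> that is kept or an entry \<open>j - 1\<close> that is
  raised. The value \<open>N - 1\<close> is raised to \<open>0\<close>, which is not counted.
\<close>

lemma sum_mem_weight_orbit_iff:
  assumes \<nu>: "\<nu> \<in> dominant_weights N"
  shows "(\<lambda>i. (x i + y i) mod int N) \<in> weight_orbit N \<nu> \<longleftrightarrow>
    strip_weight N \<mu> (overlap N x y) = \<nu>"
proof -
  let ?z = "\<lambda>i. (x i + y i) mod int N"
  have fin: "finite {i. ?z i \<noteq> 0}"
    by (rule finite_subset[OF _ finite_UnI[OF left_summand(1) right_summand(1)]]) auto
  have card: "card {i. ?z i = int j} = Poly_Mapping.lookup (strip_weight N \<mu> (overlap N x y)) j"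
    if j: "j \<in> {1..N - 1}" for j
  proof -
    have "?z i = int j \<longleftrightarrow> x i = int j \<and> y i = 0 \<or> x i = int (j - 1) \<and> y i = 1" for i
    proof (cases "y i = 0")
      case True
      then show ?thesis using left_summand(2)[of i] by auto
    next
      case False
      then have y1: "y i = 1" using right_summand(2)[of i] by simp
      show ?thesis
      proof (cases "x i = int N - 1")
        case True
        then show ?thesis using j y1 by auto
      next
        case False
        then have "?z i = x i + 1" using left_summand(2)[of i] y1 by (auto intro!: mod_pos_pos_trivial)
        then show ?thesis using j y1 by auto
      qed
    qed
    then have "{i. ?z i = int j} = {i. x i = int j \<and> y i = 0} \<union> {i. x i = int (j - 1) \<and> y i = 1}"
      by blast
    then have "card {i. ?z i = int j} =
        card {i. x i = int j \<and> y i = 0} + card {i. x i = int (j - 1) \<and> y i = 1}"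
      using j by (simp only:) (intro card_Un_disjoint finite_overlap finite_subset[OF _ finite_left_fibre[of "int j"]], auto)
    also have "\<dots> = Poly_Mapping.lookup \<mu> j - overlap N x y j + overlap N x y (j - 1)"
      using j by (simp only: card_rest[OF j]) (auto simp: overlap_def)
    also have "\<dots> = Poly_Mapping.lookup (strip_weight N \<mu> (overlap N x y)) j"
      using overlap_le[OF j] j by (simp add: lookup_strip_weight)
    finally show ?thesis .
  qed
  have "?z \<in> weight_orbit N \<nu> \<longleftrightarrow>
      (\<forall>j\<in>{1..N - 1}. Poly_Mapping.lookup (strip_weight N \<mu> (overlap N x y)) j = Poly_Mapping.lookup \<nu> j)"
    using N fin card by (auto simp: weight_orbit_iff)
  also have "\<dots> \<longleftrightarrow> strip_weight N \<mu> (overlap N x y) = \<nu>"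
    using dominant_weights_eqI[OF strip_weight_dominant \<nu>] by auto
  finally show ?thesis .
qed

end

text \<open>
  In an element \<open>x\<close> of the orbit, choose \<open>\<beta>\<^sub>j\<close> of the positions with entry \<open>j\<close> and let \<open>y\<close> be \<open>1\<close> there. For
  \<open>j = 0\<close> there are infinitely many positions to choose from.
\<close>

lemma ex_overlap:
  assumes N: "2 \<le> N" and \<beta>: "\<beta> \<in> pieri_strips N m \<mu>"
  shows "\<exists>x y. x \<in> weight_orbit N \<mu> \<and> y \<in> weight_orbit N (Poly_Mapping.single 1 m) \<and> overlap N x y = \<beta>"
proof -
  define x where "x = weight_seq N \<mu>"
  have "x \<in> orbit S_inf seq_act x"
    unfolding orbit_seq_act using permutation_id by (auto intro!: exI[of _ id])
  then have x: "x \<in> weight_orbit N \<mu>" by (simp add: weight_orbit_def x_def)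
  then have fin: "finite {i. x i \<noteq> 0}"
    and card: "j \<in> {1..N - 1} \<Longrightarrow> card {i. x i = int j} = Poly_Mapping.lookup \<mu> j" for j
    using N by (auto simp: weight_orbit_iff)
  have "\<exists>P. P \<subseteq> {i. x i = int j} \<and> finite P \<and> card P = \<beta> j" if "j < N" for j
  proof (cases "j = 0")
    case True
    have "infinite {i. x i = int j}"
    proof
      assume "finite {i. x i = int j}"
      with fin have "finite ({i. x i = int j} \<union> {i. x i \<noteq> 0})" by blast
      also have "{i. x i = int j} \<union> {i. x i \<noteq> 0} = UNIV" using True by auto
      finally show False by simp
    qed
    then show ?thesis using infinite_arbitrarily_large by blast
  next
    case False
    then obtain k where k: "j = Suc k" by (cases j) auto
    have "\<beta> j \<le> Poly_Mapping.lookup \<mu> j"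
      using \<beta> that by (simp add: k pieri_strips_def)
    also have "\<dots> = card {i. x i = int j}"
      using that by (intro card[symmetric]) (simp add: k)
    finally have "\<beta> j \<le> card {i. x i = int j}" .
    then show ?thesis by (metis obtain_subset_with_card_n)
  qed
  then obtain P where P: "\<And>j. j < N \<Longrightarrow> P j \<subseteq> {i. x i = int j} \<and> finite (P j) \<and> card (P j) = \<beta> j"
    by metis
  define y :: "nat \<Rightarrow> int" where "y i = (if i \<in> (\<Union>j<N. P j) then 1 else 0)" for i
  have y1: "{i. y i = 1} = (\<Union>j<N. P j)" and y0: "{i. y i \<noteq> 0} = (\<Union>j<N. P j)"
    by (auto simp: y_def)
  have x_P: "x k = int j" if "k \<in> P j" "j < N" for j k
    using P that by blast
  have "card (\<Union>j<N. P j) = (\<Sum>j<N. card (P j))"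
  proof (intro card_UN_disjoint ballI impI)
    fix i j assume "i \<in> {..<N}" "j \<in> {..<N}" "i \<noteq> j"
    then show "P i \<inter> P j = {}" using x_P[of _ i] x_P[of _ j] by fastforce
  qed (use P in auto)
  also have "\<dots> = m"
    using P \<beta> by (simp add: pieri_strips_def compositionsD)
  finally have card_y: "card (\<Union>j<N. P j) = m" .
  have "y \<in> weight_orbit N (Poly_Mapping.single 1 m)"
    unfolding weight_orbit_first_fundamental[OF N] y1 y0 card_y using P by (auto simp: y_def)
  moreover have "overlap N x y = \<beta>"
  proof
    fix j
    show "overlap N x y j = \<beta> j"
    proof (cases "j < N")
      case True
      have "{i. x i = int j \<and> y i = 1} = P j"
        using P True by (auto simp: y_def) fastforce
      then show ?thesis using True P by (simp add: overlap_def)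
    next
      case False
      have "\<beta> \<in> compositions N m" using \<beta> by (simp add: pieri_strips_def)
      with False show ?thesis by (simp add: overlap_def compositionsD(1)[of \<beta> N m])
    qed
  qed
  ultimately show ?thesis using x by blast
qed

text \<open>
  The pair sequence \<open>i \<mapsto> (x\<^sub>i, y\<^sub>i)\<close> takes the value \<open>(j, 1)\<close> exactly \<open>\<beta>\<^sub>j\<close> times and, for \<open>j \<noteq> 0\<close>,
  the value \<open>(j, 0)\<close> exactly \<open>a\<^sub>j - \<beta>\<^sub>j\<close> times. All other values but \<open>(0, 0)\<close> do not occur.
\<close>

lemma ex_permutation_iff_overlap_eq:
  assumes N: "2 \<le> N"
    and x: "x \<in> weight_orbit N \<mu>" "x' \<in> weight_orbit N \<mu>"
    and y: "y \<in> weight_orbit N (Poly_Mapping.single 1 m)" "y' \<in> weight_orbit N (Poly_Mapping.single 1 m)"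
  shows "(\<exists>p. permutation p \<and> x = x' \<circ> p \<and> y = y' \<circ> p) \<longleftrightarrow> overlap N x y = overlap N x' y'"
proof
  assume "\<exists>p. permutation p \<and> x = x' \<circ> p \<and> y = y' \<circ> p"
  then obtain p where p: "permutation p" "x = x' \<circ> p" "y = y' \<circ> p" by blast
  show "overlap N x y = overlap N x' y'"
    using card_fibre_comp_permutation[OF p(1), of "\<lambda>i. (x' i, y' i)"]
    by (auto simp: overlap_def p(2,3) fun_eq_iff)
next
  assume eq: "overlap N x y = overlap N x' y'"
  note px = left_summand[OF N x(1) y(1)] left_summand[OF N x(2) y(2)]
  note py = right_summand[OF N x(1) y(1)] right_summand[OF N x(2) y(2)]
  let ?f = "\<lambda>i. (x i, y i)" and ?g = "\<lambda>i. (x' i, y' i)"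
  have "\<exists>p. permutation p \<and> ?f = ?g \<circ> p"
  proof (rule ex_permutation_if_card_fibres_eq)
    show "finite {i. ?f i \<noteq> (0, 0)}" "finite {i. ?g i \<noteq> (0, 0)}"
      by (rule finite_subset[OF _ finite_UnI[OF px(1) py(1)]], auto)
        (rule finite_subset[OF _ finite_UnI[OF px(4) py(4)]], auto)
    fix v :: "int \<times> int" assume v: "v \<noteq> (0, 0)"
    obtain u w where uw: "v = (u, w)" by (cases v)
    show "card {i. ?f i = v} = card {i. ?g i = v}"
    proof (cases "u \<in> {0..<int N} \<and> w \<in> {0, 1}")
      case False
      have "{i. ?f i = v} = {}" "{i. ?g i = v} = {}"
        using False px(2,5) py(2,5) by (force simp: uw)+
      then show ?thesis by simp
    next
      case True
      define j where "j = nat u"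
      have j: "u = int j" "j < N" using True by (auto simp: j_def)
      show ?thesis
      proof (cases "w = 1")
        case True
        then show ?thesis using fun_cong[OF eq, of j] j by (simp add: uw overlap_def)
      next
        case False
        then have "w = 0" "j \<in> {1..N - 1}" using \<open>u \<in> _ \<and> _\<close> v j by (auto simp: uw)
        then show ?thesis
          using card_rest[OF N x(1) y(1), of j] card_rest[OF N x(2) y(2), of j]
          by (simp add: uw j eq)
      qed
    qed
  qed
  then show "\<exists>p. permutation p \<and> x = x' \<circ> p \<and> y = y' \<circ> p"
    by (auto simp: fun_eq_iff)
qed

lemma card_image_eq_if_same_fibres:
  assumes "\<And>s t. s \<in> T \<Longrightarrow> t \<in> T \<Longrightarrow> f s = f t \<longleftrightarrow> g s = g t"
  shows "card (f ` T) = card (g ` T)"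
proof -
  have "bij_betw (\<lambda>u. g (SOME t. t \<in> T \<and> f t = u)) (f ` T) (g ` T)"
  proof -
    have some: "(SOME s. s \<in> T \<and> f s = f t) \<in> T \<and> f (SOME s. s \<in> T \<and> f s = f t) = f t" if "t \<in> T" for t
      by (rule someI[of _ t]) (use that in simp)
    then have "g (SOME s. s \<in> T \<and> f s = f t) = g t" if "t \<in> T" for t
      using assms that by blast
    then show ?thesis
      using assms by (auto simp: bij_betw_def inj_on_def image_image)
  qed
  then show ?thesis by (rule bij_betw_same_card)
qed

text \<open>
  The overlap of \<open>x\<close> and \<open>y\<close> is a complete invariant of the orbit of \<open>(x, y, x + y)\<close>, and its values
  are the strips leading from \<open>\<mu>\<close> to \<open>\<nu>\<close>.
\<close>

theorem orbit_number_eq_card_pieri_strips: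
  assumes N: "2 \<le> N" and \<nu>: "\<nu> \<in> dominant_weights N"
  shows "orbit_number N (weight_orbit N \<mu>) (weight_orbit N (Poly_Mapping.single 1 m)) (weight_orbit N \<nu>) =
    card {\<beta> \<in> pieri_strips N m \<mu>. strip_weight N \<mu> \<beta> = \<nu>}"
proof -
  define lam :: weight where "lam = Poly_Mapping.single 1 m"
  note facts = sum_mem_weight_orbit_iff[OF N, where m = m, folded lam_def]
    ex_permutation_iff_overlap_eq[OF N, where m = m, folded lam_def]
    overlap_in_pieri_strips[OF N, where m = m, folded lam_def]
    ex_overlap[OF N, where m = m, folded lam_def]
  let ?T = "sum_triples N (weight_orbit N \<mu>) (weight_orbit N lam) (weight_orbit N \<nu>)"
  let ?ov = "\<lambda>(x, y, z). overlap N x y"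
  have T: "(x, y, z) \<in> ?T \<longleftrightarrow> x \<in> weight_orbit N \<mu> \<and> y \<in> weight_orbit N lam \<and>
      z = (\<lambda>i. (x i + y i) mod int N) \<and> strip_weight N \<mu> (overlap N x y) = \<nu>" for x y z
    using N facts(1)[OF _ _ \<nu>, of x \<mu> y] by (auto simp: sum_triples_iff)
  have "card (orbits S_inf ?T diag_act) = card (orbit S_inf diag_act ` ?T)"
    by (simp add: orbits_def image_def Bex_def conj_commute)
  also have "\<dots> = card (?ov ` ?T)"
  proof (rule card_image_eq_if_same_fibres)
    fix s t assume "s \<in> ?T" "t \<in> ?T"
    then obtain x y z x' y' z' where s: "s = (x, y, z)" "(x, y, z) \<in> ?T"
      and t: "t = (x', y', z')" "(x', y', z') \<in> ?T"
      by (cases s; cases t) auto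
    have "orbit S_inf diag_act s = orbit S_inf diag_act t \<longleftrightarrow>
        (\<exists>p. permutation p \<and> x = x' \<circ> p \<and> y = y' \<circ> p)"
      using s(2) t(2) unfolding s(1) t(1) orbit_diag_act_eq_iff T by (auto simp: fun_eq_iff)
    also have "\<dots> \<longleftrightarrow> ?ov s = ?ov t"
      using s(2) t(2) facts(2)[of x \<mu> x' y y']
      unfolding s(1) t(1) T by simp
    finally show "orbit S_inf diag_act s = orbit S_inf diag_act t \<longleftrightarrow> ?ov s = ?ov t" .
  qed
  also have "?ov ` ?T = {\<beta> \<in> pieri_strips N m \<mu>. strip_weight N \<mu> \<beta> = \<nu>}"
  proof (intro equalityI subsetI)
    fix \<beta> assume "\<beta> \<in> ?ov ` ?T"
    then show "\<beta> \<in> {\<beta> \<in> pieri_strips N m \<mu>. strip_weight N \<mu> \<beta> = \<nu>}"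
      using facts(3) by (auto simp: T)
  next
    fix \<beta> assume \<beta>: "\<beta> \<in> {\<beta> \<in> pieri_strips N m \<mu>. strip_weight N \<mu> \<beta> = \<nu>}"
    then obtain x y where "x \<in> weight_orbit N \<mu>" "y \<in> weight_orbit N lam"
        "overlap N x y = \<beta>"
      using facts(4) by blast
    with \<beta> have "(x, y, \<lambda>i. (x i + y i) mod int N) \<in> ?T" "\<beta> = ?ov (x, y, \<lambda>i. (x i + y i) mod int N)"
      by (simp_all add: T)
    then show "\<beta> \<in> ?ov ` ?T" by (rule rev_image_eqI)
  qed
  finally show ?thesis by (simp add: orbit_number_def lam_def)
qed

section \<open>Comparison of the two counts\<close>

theorem theorem6p2p6:
  fixes N m :: nat and lam \<mu> \<nu> :: weight
  assumes "N \<ge> 2" and "m \<ge> 1"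
    and "lam = Poly_Mapping.single 1 m"
    and "\<mu> \<in> dominant_weights N"
    and "\<nu> \<in> dominant_weights N"
  shows "lr_coeff N \<mu> lam \<nu> =
         of_nat (orbit_number N (weight_orbit N \<mu>) (weight_orbit N lam) (weight_orbit N \<nu>))"
  unfolding assms(3)
  by (simp only: lr_coeff_eq_card_pieri_strips[OF assms(1)]
      orbit_number_eq_card_pieri_strips[OF assms(1,5)])

end
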